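(* Consider running SDA (the stochastic dual accelerated algorithm described in the context) on the online stochastic distributed averaging problem, with number of iterations $T$ and with the parameters $$T_0=\frac{T}{2}\ge k^*,\qquad \eta=\frac{1}{\lambda_1(L)},\qquad \zeta=\frac{\sqrt{\kappa(L)}-1}{\sqrt{\kappa(L)}+1},$$ where $T_0$ is an integer. Let $\{\widehat\theta_{i,T}\}_{i\in\mathcal N}$ be the output of SDA. Then $$\mathbb E\left[\sum_{i=1}^N\|\widehat\theta_{i,T}-\bar\mu\|_2^2\right]\le \frac{16\,\kappa(L)}{T^2}\,e^{-\frac{T}{2\sqrt{\kappa(L)}}}\sum_{i=1}^N\|\mu_i-\bar\mu\|_2^2+\frac{24\left(k^*+\sqrt{\kappa(L)}\right)\sum_{i=1}^N\sum_{j=1}^n\sigma_{i,j}^2}{T^2}+\frac{2\sum_{j=1}^n\max_{i\in\mathcal N}\sigma_{i,j}^2}{T}.$$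
   Context: **Network.** $\mathcal G=(\mathcal N,\mathcal E)$ is a simple, connected, undirected graph with nodes $\mathcal N=\{1,\dots,N\}$, $N\ge 2$; $\mathcal N_i=\{j:(i,j)\in\mathcal E\}$ is the set of neighbors of $i$. **Data.** At each time $t=0,1,2,\dots$ each node $i$ observes a random vector $R_{i,t}\in\mathbb R^n$ with mean $\mu_i\in\mathbb R^n$ and covariance matrix $\Sigma_i\in\mathbb R^{n\times n}$; $\sigma_{i,1}^2,\dots,\sigma_{i,n}^2$ are the diagonal entries of $\Sigma_i$ (the variances of the components of $R_{i,t}$). The vectors $R_{i,t}$ are independent across times $t$ and nodes $i$. The target is $\bar\mu=\frac1N\sum_{i=1}^N\mu_i$. **Gossip matrix.** $L=[L_{i,j}]\in\mathbb R^{N\times N}$ satisfies: (1) $L$ is symmetric positive semi-definite; (2) $L_{i,j}\ne0$ only if $i=j$ or $(i,j)\in\mathcal E$; (3) the kernel of $L$ is the set of all constant vectors. Its eigenvalues are $0=\lambda_N(L)<\lambda_{N-1}(L)\le\dots\le\lambda_1(L)$, and $\kappa(L)=\lambda_1(L)/\lambda_{N-1}(L)$. **$k^*$.** $k^*$ is the smallest positive integer such that for all integers $k\ge k^*$, $$\left(1+\frac{k}{\sqrt{\kappa(L)}+1}\right)\left(1-\frac1{\sqrt{\kappa(L)}}\right)^k\le\left(1-\frac1{2\sqrt{\kappa(L)}}\right)^k.$$ **Algorithm SDA.** Inputs: number of iterations $T>0$, burn-in time $T_0\in[0,T-1]$, gossip matrix $L$, step-size $\eta>0$, momentum parameter $\zeta\ge0$.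 Initialize $x_{i,0}=y_{i,0}=0\in\mathbb R^n$ for all $i\in\mathcal N$. For $t=0,\dots,T-1$, each node $i$ computes $$\theta_{i,t}=x_{i,t}+R_{i,t},\qquad y_{i,t+1}=x_{i,t}-\eta\sum_{j\in\mathcal N_i\cup\{i\}}L_{i,j}\theta_{j,t},\qquad x_{i,t+1}=y_{i,t+1}+\zeta(y_{i,t+1}-y_{i,t}).$$ Output: $\widehat\theta_{i,T}=\frac1{T-T_0}\sum_{t=T_0}^{T-1}\theta_{i,t}$ for all $i\in\mathcal N$. *)

theory Defs
  imports "HOL-Probability.Probability" "HOL-Computational_Algebra.Computational_Algebra"
begin

definition connected_simple_graph :: "('v \<times> 'v) set \<Rightarrow> bool" where
  "connected_simple_graph E \<longleftrightarrow> sym E \<and> irrefl E \<and> (\<forall>i j. (i, j) \<in> E\<^sup>*)"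

definition nbrs :: "('v \<times> 'v) set \<Rightarrow> 'v \<Rightarrow> 'v set" where
  "nbrs E i = {j. (i, j) \<in> E}"

definition gossip_matrix :: "('v::finite \<times> 'v) set \<Rightarrow> real^'v^'v \<Rightarrow> bool" where
  "gossip_matrix E L \<longleftrightarrow>
     transpose L = L \<and>
     (\<forall>u. 0 \<le> u \<bullet> (L *v u)) \<and>
     (\<forall>i j. L $ i $ j \<noteq> 0 \<longrightarrow> i = j \<or> (i, j) \<in> E) \<and>
     {u. L *v u = 0} = range (\<lambda>c. \<chi> i. c)"

definition charpoly :: "real^'v^'v \<Rightarrow> real poly" where
  "charpoly A = det (\<chi> i j. (if i = j then [:0, 1:] else 0) - [:A $ i $ j:])"

text \<open>
  The real eigenvalues with algebraic multiplicity, in decreasing order. For a symmetric matrix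
  these are all \<open>CARD('v)\<close> eigenvalues. Indices of \<open>eigval\<close> start at 1, so that \<open>eigval A 1\<close>
  is the largest eigenvalue.
\<close>

definition eigval :: "real^'v^'v \<Rightarrow> nat \<Rightarrow> real" where
  "eigval A k = rev (sorted_list_of_multiset (proots (charpoly A))) ! (k - 1)"

definition cond_num :: "real^'v^'v \<Rightarrow> real" where
  "cond_num L = eigval L 1 / eigval L (CARD('v) - 1)"

definition k_star :: "real \<Rightarrow> nat" where
  "k_star \<kappa> = (LEAST k. k \<ge> 1 \<and>
     (\<forall>m\<ge>k. (1 + real m / (sqrt \<kappa> + 1)) * (1 - 1 / sqrt \<kappa>) ^ m \<le> (1 - 1 / (2 * sqrt \<kappa>)) ^ m))"

context prob_space
begin

definition has_mean :: "('a \<Rightarrow> real^'n) \<Rightarrow> real^'n \<Rightarrow> bool" where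
  "has_mean X m \<longleftrightarrow> integrable M X \<and> expectation X = m"

definition has_covariance :: "('a \<Rightarrow> real^'n) \<Rightarrow> real^'n^'n \<Rightarrow> bool" where
  "has_covariance X S \<longleftrightarrow>
     (\<forall>j k. integrable M (\<lambda>\<omega>. (X \<omega> $ j - expectation X $ j) * (X \<omega> $ k - expectation X $ k)) \<and>
            expectation (\<lambda>\<omega>. (X \<omega> $ j - expectation X $ j) * (X \<omega> $ k - expectation X $ k)) = S $ j $ k)"

text \<open>\<open>R i t\<close> is the vector observed by node \<open>i\<close> at time \<open>t\<close>; all of them are jointly independent.\<close>

definition observations ::
    "('v \<Rightarrow> nat \<Rightarrow> 'a \<Rightarrow> real^'n) \<Rightarrow> ('v \<Rightarrow> real^'n) \<Rightarrow> ('v \<Rightarrow> real^'n^'n) \<Rightarrow> bool" where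
  "observations R \<mu> \<Sigma> \<longleftrightarrow>
     (\<forall>i t. has_mean (R i t) (\<mu> i) \<and> has_covariance (R i t) (\<Sigma> i)) \<and>
     indep_vars (\<lambda>_. borel) (\<lambda>(i, t). R i t) UNIV"

end

text \<open>
  The algorithm runs on one realisation \<open>r\<close> of the observations; \<open>r i t\<close> is the value seen by
  node \<open>i\<close> at time \<open>t\<close>.
\<close>

fun sda_x sda_y ::
    "('v::finite \<times> 'v) set \<Rightarrow> real^'v^'v \<Rightarrow> real \<Rightarrow> real \<Rightarrow> ('v \<Rightarrow> nat \<Rightarrow> real^'n) \<Rightarrow>
     nat \<Rightarrow> 'v \<Rightarrow> real^'n" where
  "sda_x E L \<eta> \<zeta> r 0 i = 0"
| "sda_y E L \<eta> \<zeta> r 0 i = 0"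
| "sda_y E L \<eta> \<zeta> r (Suc t) i =
     sda_x E L \<eta> \<zeta> r t i
     - \<eta> *\<^sub>R (\<Sum>j\<in>nbrs E i \<union> {i}. L $ i $ j *\<^sub>R (sda_x E L \<eta> \<zeta> r t j + r j t))"
| "sda_x E L \<eta> \<zeta> r (Suc t) i =
     sda_y E L \<eta> \<zeta> r (Suc t) i
     + \<zeta> *\<^sub>R (sda_y E L \<eta> \<zeta> r (Suc t) i - sda_y E L \<eta> \<zeta> r t i)"

definition sda_theta ::
    "('v::finite \<times> 'v) set \<Rightarrow> real^'v^'v \<Rightarrow> real \<Rightarrow> real \<Rightarrow> ('v \<Rightarrow> nat \<Rightarrow> real^'n) \<Rightarrow>
     nat \<Rightarrow> 'v \<Rightarrow> real^'n" where
  "sda_theta E L \<eta> \<zeta> r t i = sda_x E L \<eta> \<zeta> r t i + r i t"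

definition sda_output ::
    "('v::finite \<times> 'v) set \<Rightarrow> real^'v^'v \<Rightarrow> real \<Rightarrow> real \<Rightarrow> nat \<Rightarrow> nat \<Rightarrow> ('v \<Rightarrow> nat \<Rightarrow> real^'n) \<Rightarrow>
     'v \<Rightarrow> real^'n" where
  "sda_output E L \<eta> \<zeta> T T0 r i =
     (1 / (real T - real T0)) *\<^sub>R (\<Sum>t = T0..<T. sda_theta E L \<eta> \<zeta> r t i)"

end

theory Submission
  imports Defs
begin

(* Leaves $ to denote vector components only, which removes exponentially many parses. *)
unbundle no Formal_Power_Series.fps_syntax

text \<open>
  The algorithm is linear and commutes with the gossip matrix \<open>L\<close>, so it is analysed in an
  orthonormal eigenbasis of \<open>L\<close>. The spectral theorem is proved for this purpose, together with the
  factorisation of the characteristic polynomial that identifies the eigenvalues in the condition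
  number (\<open>gossip_matrix_eigenbasis\<close>).

  Along an eigenvector with eigenvalue \<open>\<lambda>\<close> the algorithm is a scalar momentum recursion with
  parameter \<open>a = 1 - \<eta> \<lambda>\<close>. Let \<open>e\<^sub>t = damping \<zeta> a t\<close> be its response to a constant input 1. The sum
  of the iterates before time \<open>t\<close> is the convolution of the input with \<open>e\<close>
  (\<open>sum_momentum_iterates\<close>), so the output, an average over \<open>T0 \<le> t < T\<close>, is a linear combination of
  the inputs whose weights are values of \<open>e\<close> or differences of two such values
  (\<open>sda_output_eigenvector\<close>).

  On the constant vectors \<open>a = 1\<close> and \<open>e = 1\<close>: the output is the plain average of the inputs in the
  window, unbiased, with variance bounded by the last term of the estimate. For all other modes
  \<open>0 \<le> a \<le> 1 - 1 / \<kappa>\<close>, and \<open>\<bar>e\<^sub>t\<bar>\<close> is bounded by the left-hand side of the inequality that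
  defines \<open>k_star\<close> (\<open>abs_damping_le\<close>). Hence \<open>\<bar>e\<^sub>t\<bar> \<le> 1\<close> always (\<open>damping_bound_le_1\<close>) and
  \<open>\<bar>e\<^sub>t\<bar> \<le> (1 - 1 / (2 sqrt \<kappa>)) ^ t\<close> from \<open>k_star\<close> on. The bias of such a mode is the average of
  \<open>e\<close> over the window, a geometric sum (\<open>bias_factor_le\<close>). Its variance is governed by the sum of the
  squared weights, which is at most three times the sum of all \<open>e\<^sub>t\<^sup>2\<close>, of order
  \<open>k_star + sqrt \<kappa>\<close> (\<open>sum_tail_weight_squares_le\<close>). Independence of the observations separates bias
  and variance in each mode (\<open>observations_second_moment\<close>), and Parseval's identity adds up the
  modes.
\<close>

section \<open>Orthonormal eigenbases of symmetric matrices and the spectrum of a gossip matrix\<close>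

lemma symmetric_matrix_inner:
  fixes A :: "real^'v^'v"
  assumes "transpose A = A"
  shows "(A *v x) \<bullet> y = x \<bullet> (A *v y)"
  by (metis assms dot_lmul_matrix transpose_matrix_vector)

text \<open>
  A unit vector of \<open>S\<close> maximising the Rayleigh quotient exists by compactness, and it is an
  eigenvector: the quotient cannot increase to first order in the direction of the residual
  \<open>A *v v - l *\<^sub>R v\<close>, and its derivative in that direction is the squared norm of the residual.
\<close>

lemma symmetric_matrix_eigenvector:
  fixes A :: "real^'v^'v"
  assumes sym: "transpose A = A" and S: "subspace S" and inv: "\<And>x. x \<in> S \<Longrightarrow> A *v x \<in> S"
    and nontrivial: "S \<noteq> {0}"
  shows "\<exists>v\<in>S. \<exists>l. norm v = 1 \<and> A *v v = l *\<^sub>R v"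
proof -
  let ?K = "S \<inter> sphere 0 1"
  have "0 \<in> S" using S by (rule subspace_0)
  with nontrivial obtain u where u: "u \<in> S" "u \<noteq> 0" by blast
  have "(1 / norm u) *\<^sub>R u \<in> ?K"
    using u S by (auto simp: subspace_scale)
  then have ne: "?K \<noteq> {}" by blast
  have compact: "compact ?K"
    using closed_subspace[OF S] by (simp add: closed_Int_compact)
  have "continuous_on ?K (\<lambda>x. x \<bullet> (A *v x))"
    by (intro continuous_intros linear_continuous_on
        linear_conv_bounded_linear[THEN iffD1] matrix_vector_mul_linear)
  from continuous_attains_sup[OF compact ne this] obtain v where
    v: "v \<in> S" "norm v = 1" and max: "\<And>x. x \<in> ?K \<Longrightarrow> x \<bullet> (A *v x) \<le> v \<bullet> (A *v v)"
    by auto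
  define l where "l = v \<bullet> (A *v v)"
  have bound: "x \<bullet> (A *v x) \<le> l * (x \<bullet> x)" if "x \<in> S" for x
  proof (cases "x = 0")
    case False
    then have "(1 / norm x) *\<^sub>R x \<in> ?K" using that S by (auto simp: subspace_scale)
    from max[OF this] have "(1 / norm x)\<^sup>2 * (x \<bullet> (A *v x)) \<le> l"
      by (simp add: l_def matrix_vector_mult_scaleR power2_eq_square)
    then show ?thesis using False
      by (simp add: dot_square_norm field_simps)
  qed auto
  define w where "w = A *v v - l *\<^sub>R v"
  define C where "C = l * (w \<bullet> w) - w \<bullet> (A *v w)"
  have w: "w \<in> S" unfolding w_def using S v inv by (simp add: subspace_diff subspace_scale)
  \<comment> \<open>Maximality of \<open>v\<close>, tested at \<open>v + t *\<^sub>R w\<close>: the constant terms cancel, and the linear term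
    must be dominated by the quadratic one for every \<open>t\<close>, which fails for small \<open>t > 0\<close> unless \<open>w = 0\<close>.\<close>
  have quad: "2 * t * (w \<bullet> w) \<le> t\<^sup>2 * C" for t
  proof -
    have vv: "v \<bullet> v = 1" using v(2) by (simp add: dot_square_norm)
    have s: "v \<bullet> (A *v w) = w \<bullet> (A *v v)"
      using symmetric_matrix_inner[OF sym, of v w] by (simp add: inner_commute)
    have ww: "w \<bullet> (A *v v) = w \<bullet> w + l * (v \<bullet> w)"
      by (simp add: w_def algebra_simps inner_diff_right inner_diff_left inner_commute)
    have "v + t *\<^sub>R w \<in> S" using S v w by (simp add: subspace_add subspace_scale)
    from bound[OF this] show ?thesis
      using vv s ww by (simp add: C_def matrix_vector_right_distrib matrix_vector_mult_scaleR
          inner_add_left inner_add_right algebra_simps power2_eq_square l_def[symmetric] inner_commute)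
  qed
  have "w = 0"
  proof (rule ccontr)
    assume "w \<noteq> 0"
    then have pos: "w \<bullet> w > 0" by simp
    define t where "t = (w \<bullet> w) / (\<bar>C\<bar> + 1)"
    have t: "t > 0" using pos by (simp add: t_def)
    have "t * C \<le> t * (\<bar>C\<bar> + 1)" using t by (intro mult_left_mono) auto
    also have "\<dots> = w \<bullet> w" by (simp add: t_def)
    finally have tC: "t * C \<le> w \<bullet> w" .
    have "t * (2 * (w \<bullet> w)) \<le> t * (t * C)"
      using quad[of t] by (simp add: power2_eq_square algebra_simps)
    then have "2 * (w \<bullet> w) \<le> t * C" using t by simp
    with pos tC show False by linarith
  qed
  then have "A *v v = l *\<^sub>R v" by (simp add: w_def)
  with v show ?thesis by blast
qed

text \<open>
  Induction on the dimension: split off one unit eigenvector; by symmetry its orthogonal complement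
  within the invariant subspace is again invariant.
\<close>

lemma symmetric_matrix_eigenbasis_subspace:
  fixes A :: "real^'v^'v"
  assumes sym: "transpose A = A"
  shows "subspace S \<Longrightarrow> (\<And>x. x \<in> S \<Longrightarrow> A *v x \<in> S) \<Longrightarrow>
    \<exists>B\<subseteq>S. pairwise orthogonal B \<and> (\<forall>v\<in>B. norm v = 1 \<and> (\<exists>l. A *v v = l *\<^sub>R v)) \<and> span B = S"
proof (induction "dim S" arbitrary: S rule: less_induct)
  case less
  show ?case
  proof (cases "S = {0}")
    case True
    then show ?thesis by (intro exI[of _ "{}"]) auto
  next
    case False
    from symmetric_matrix_eigenvector[OF sym less.prems False]
    obtain v l where v: "v \<in> S" "norm v = 1" "A *v v = l *\<^sub>R v" by blast
    define S' where "S' = {x \<in> S. v \<bullet> x = 0}"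
    have sub: "subspace S'"
      using less.prems(1) by (auto simp: S'_def subspace_def inner_add_right)
    have inv: "A *v x \<in> S'" if "x \<in> S'" for x
      using that less.prems(2) symmetric_matrix_inner[OF sym, of v x] v(3) by (simp add: S'_def)
    have vv: "v \<bullet> v = 1" using v(2) by (simp add: dot_square_norm)
    then have "v \<notin> S'" by (simp add: S'_def)
    moreover have "S' \<subseteq> S" by (auto simp: S'_def)
    ultimately have "S' \<subset> S" using v(1) by blast
    then have "dim S' < dim S"
      using sub less.prems(1) by (intro dim_psubset) (simp add: span_eq_iff[THEN iffD2])
    from less.hyps[OF this sub inv] obtain B where
      B: "B \<subseteq> S'" "pairwise orthogonal B" "\<forall>v\<in>B. norm v = 1 \<and> (\<exists>l. A *v v = l *\<^sub>R v)"
        "span B = S'" by blast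
    have "S \<subseteq> span (insert v B)"
    proof
      fix x assume x: "x \<in> S"
      have "x - (v \<bullet> x) *\<^sub>R v \<in> S'"
        using x v vv less.prems(1) by (simp add: S'_def subspace_diff subspace_scale inner_diff_right)
      then show "x \<in> span (insert v B)"
        unfolding span_insert using B(4) by blast
    qed
    moreover have "insert v B \<subseteq> S" using v B by (auto simp: S'_def)
    moreover from this have "span (insert v B) \<subseteq> S"
      using less.prems(1) by (rule span_minimal)
    moreover have "pairwise orthogonal (insert v B)"
      using B(1,2) by (auto simp: pairwise_insert orthogonal_def S'_def inner_commute)
    ultimately show ?thesis
      using v B(3) by (intro exI[of _ "insert v B"]) auto
  qed
qed

text \<open>
  The real spectral theorem. The basis is indexed by the matrix index type itself, so that products
  over eigenvalues have the same range as products over diagonal entries.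
\<close>

theorem symmetric_matrix_orthonormal_eigenbasis:
  fixes A :: "real^'v^'v"
  assumes sym: "transpose A = A"
  shows "\<exists>(b :: 'v \<Rightarrow> real^'v) d.
    (\<forall>k l. b k \<bullet> b l = (if k = l then 1 else 0)) \<and> (\<forall>k. A *v b k = d k *\<^sub>R b k)"
proof -
  from symmetric_matrix_eigenbasis_subspace[OF sym subspace_UNIV]
  obtain B where B: "pairwise orthogonal B"
    "\<forall>v\<in>B. norm v = 1 \<and> (\<exists>l. A *v v = l *\<^sub>R v)" "span B = UNIV" by auto
  have ind: "independent B"
    using B(1,2) by (intro pairwise_orthogonal_independent) force+
  then have "finite B" by (simp add: independent_imp_finite)
  moreover have "card B = CARD('v)"
    using dim_span_eq_card_independent[OF ind] B(3) by simp
  ultimately obtain b :: "'v \<Rightarrow> real^'v" where b: "bij_betw b UNIV B"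
    using finite_same_card_bij[of "UNIV :: 'v set" B] by auto
  have bB: "b k \<in> B" for k using b by (auto simp: bij_betw_def)
  have "b k \<bullet> b l = (if k = l then 1 else 0)" for k l
  proof (cases "k = l")
    case True
    then show ?thesis using B(2) bB by (simp add: dot_square_norm)
  next
    case False
    then have "b k \<noteq> b l" using b by (auto simp: bij_betw_def dest: injD)
    then show ?thesis using False B(1) bB by (auto simp: pairwise_def orthogonal_def)
  qed
  moreover have "\<forall>k. \<exists>l. A *v b k = l *\<^sub>R b k" using B(2) bB by blast
  then obtain d where "\<And>k. A *v b k = d k *\<^sub>R b k" by metis
  ultimately show ?thesis by blast
qed

text \<open>
  A square matrix with orthonormal rows has orthonormal columns, because a right inverse is also a
  left inverse.
\<close>

lemma orthonormal_columns:
  fixes b :: "'v \<Rightarrow> real^'v"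
  assumes "\<And>k l. b k \<bullet> b l = (if k = l then 1 else 0)"
  shows "(\<Sum>k\<in>UNIV. b k $ i * b k $ j) = (if i = j then 1 else 0)"
proof -
  define Q :: "real^'v^'v" where "Q = (\<chi> k. b k)"
  have "Q ** transpose Q = mat 1"
    using assms by (simp add: Q_def vec_eq_iff matrix_matrix_mult_def transpose_def mat_def inner_vec_def)
  then have "transpose Q ** Q = mat 1" by (simp add: matrix_left_right_inverse)
  then have "(transpose Q ** Q) $ i $ j = mat 1 $ i $ j" by simp
  then show ?thesis by (simp add: Q_def matrix_matrix_mult_def transpose_def mat_def)
qed

lemma orthonormal_parseval:
  fixes b :: "'v \<Rightarrow> real^'v"
  assumes "\<And>k l. b k \<bullet> b l = (if k = l then 1 else 0)"
  shows "(\<Sum>i\<in>UNIV. (f i)\<^sup>2) = (\<Sum>k\<in>UNIV. (\<Sum>i\<in>UNIV. b k $ i * f i)\<^sup>2)"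
proof -
  have "(\<Sum>k\<in>UNIV. (\<Sum>i\<in>UNIV. b k $ i * f i)\<^sup>2)
      = (\<Sum>k\<in>UNIV. \<Sum>i\<in>UNIV. \<Sum>j\<in>UNIV. (f i * f j) * (b k $ i * b k $ j))"
    by (simp add: power2_eq_square sum_product algebra_simps)
  also have "\<dots> = (\<Sum>i\<in>UNIV. \<Sum>j\<in>UNIV. (f i * f j) * (\<Sum>k\<in>UNIV. b k $ i * b k $ j))"
    by (subst sum.swap, rule sum.cong[OF refl], subst sum.swap) (simp add: sum_distrib_left)
  also have "\<dots> = (\<Sum>i\<in>UNIV. (f i)\<^sup>2)"
    by (simp add: orthonormal_columns[OF assms] power2_eq_square if_distrib cong: if_cong)
  finally show ?thesis by simp
qed

definition const_poly_matrix :: "real^'v^'v \<Rightarrow> real poly^'v^'v" where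
  "const_poly_matrix A = (\<chi> i j. [:A $ i $ j:])"

lemma const_poly_matrix_mult:
  "const_poly_matrix (A ** B) = const_poly_matrix A ** const_poly_matrix B"
  by (simp add: const_poly_matrix_def vec_eq_iff matrix_matrix_mult_def mult_ac flip: sum_to_poly)

text \<open>
  The matrix \<open>P\<close> whose columns are the eigenvectors intertwines \<open>A\<close> with the diagonal matrix of
  eigenvalues. Lifted to constant polynomials it also intertwines the two characteristic matrices, so
  their determinants agree once \<open>det P\<close> is cancelled.
\<close>

lemma charpoly_eigenbasis:
  fixes A :: "real^'v^'v" and b :: "'v \<Rightarrow> real^'v"
  assumes orth: "\<And>k l. b k \<bullet> b l = (if k = l then 1 else 0)"
    and eig: "\<And>k. A *v b k = d k *\<^sub>R b k"
  shows "charpoly A = (\<Prod>k\<in>UNIV. [:- d k, 1:])"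
proof -
  define P :: "real^'v^'v" where "P = (\<chi> i k. b k $ i)"
  define X where "X A = (\<chi> i j. (if i = j then [:0, 1:] else 0) - [:A $ i $ j:])" for A :: "real^'v^'v"
  define D :: "real^'v^'v" where "D = (\<chi> k l. if k = l then d k else 0)"
  have "(\<Sum>j\<in>UNIV. A $ i $ j * b k $ j) = d k * b k $ i" for i k
    using arg_cong[OF eig[of k], of "\<lambda>x. x $ i"] by (simp add: matrix_vector_mult_def)
  then have AP: "A ** P = P ** D"
    by (simp add: vec_eq_iff matrix_matrix_mult_def P_def D_def if_distrib mult.commute cong: if_cong)
  have PP: "P ** transpose P = mat 1"
    by (simp add: vec_eq_iff matrix_matrix_mult_def P_def transpose_def mat_def
        orthonormal_columns[OF orth])
  let ?C = const_poly_matrix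
  have "X A ** ?C P = ?C P ** X D"
  proof -
    have "(X A ** ?C P) $ i $ j = (?C P ** X D) $ i $ j" for i j
    proof -
      have "(X A ** ?C P) $ i $ j = [:0,1:] * [:P $ i $ j:] - (?C A ** ?C P) $ i $ j"
        by (simp add: X_def const_poly_matrix_def matrix_matrix_mult_def left_diff_distrib
            sum_subtractf if_distrib[of "\<lambda>x. x * _"] del: mult_pCons_left mult_pCons_right cong: if_cong)
      also have "?C A ** ?C P = ?C P ** ?C D"
        using AP by (metis const_poly_matrix_mult)
      also have "[:0,1:] * [:P $ i $ j:] - (?C P ** ?C D) $ i $ j = (?C P ** X D) $ i $ j"
        by (simp add: X_def const_poly_matrix_def matrix_matrix_mult_def right_diff_distrib
            sum_subtractf if_distrib[of "\<lambda>x. _ * x"] mult.commute del: mult_pCons_left mult_pCons_right cong: if_cong)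
      finally show ?thesis .
    qed
    then show ?thesis by (simp add: vec_eq_iff)
  qed
  then have "det (X A) * det (?C P) = det (?C P) * det (X D)"
    by (metis det_mul)
  moreover have "det (?C P) \<noteq> 0"
  proof -
    have "?C P ** ?C (transpose P) = mat 1"
      unfolding const_poly_matrix_mult[symmetric] PP
      by (simp add: const_poly_matrix_def mat_def vec_eq_iff)
    then have "det (?C P) * det (?C (transpose P)) = 1"
      by (metis det_I det_mul)
    then show ?thesis by auto
  qed
  ultimately have "det (X A) = det (X D)" by simp
  also have "\<dots> = (\<Prod>k\<in>UNIV. X D $ k $ k)"
    by (rule det_diagonal) (simp add: X_def D_def)
  finally show ?thesis by (simp add: charpoly_def X_def D_def)
qed

text \<open>
  Exactly one basis vector \<open>b k0\<close> has eigenvalue 0: the kernel consists of the constant vectors, and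
  two constant unit vectors are never orthogonal. Hence the sorted list of roots of the characteristic
  polynomial is \<open>0 # l\<close> with \<open>l\<close> the sorted list of the positive eigenvalues, and the two indexed
  eigenvalues in the condition number are the last and the first entry of \<open>l\<close>.
\<close>

lemma gossip_matrix_eigenbasis:
  fixes L :: "real^'v^'v"
  assumes N: "CARD('v) \<ge> 2" and L: "gossip_matrix E L"
  obtains b :: "'v \<Rightarrow> real^'v" and d :: "'v \<Rightarrow> real" and k0 :: 'v where
    "\<And>k l. b k \<bullet> b l = (if k = l then 1 else 0)" "\<And>k. L *v b k = d k *\<^sub>R b k"
    "d k0 = 0" "\<And>i j. b k0 $ i = b k0 $ j"
    "\<And>k. k \<noteq> k0 \<Longrightarrow> eigval L (CARD('v) - 1) \<le> d k \<and> d k \<le> eigval L 1"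
    "0 < eigval L (CARD('v) - 1)" "eigval L (CARD('v) - 1) \<le> eigval L 1"
proof -
  have sym: "transpose L = L" and psd: "\<And>u. 0 \<le> u \<bullet> (L *v u)"
    and ker: "{u. L *v u = 0} = range (\<lambda>c. \<chi> i. c)"
    using L by (auto simp: gossip_matrix_def)
  obtain b :: "'v \<Rightarrow> real^'v" and d where orth: "\<And>k l. b k \<bullet> b l = (if k = l then 1 else 0)"
    and eig: "\<And>k. L *v b k = d k *\<^sub>R b k"
    using symmetric_matrix_orthonormal_eigenbasis[OF sym] by metis
  have bn0: "b k \<noteq> 0" for k using orth[of k k] by auto
  have d0: "d k \<ge> 0" for k using psd[of "b k"] by (simp add: eig orth)
  let ?one = "(\<chi> i. 1) :: real^'v"
  have Lone: "L *v ?one = 0" using ker by auto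
  \<comment> \<open>The constant vector is not orthogonal to the whole basis; any basis vector that it meets lies in
    the kernel, since eigenspaces of different eigenvalues are orthogonal.\<close>
  have "\<exists>k. ?one \<bullet> b k \<noteq> 0"
  proof (rule ccontr)
    assume "\<not> ?thesis"
    then have "(\<Sum>i\<in>UNIV. b k $ i * 1) = 0" for k by (simp add: inner_vec_def)
    then have "(\<Sum>i\<in>(UNIV :: 'v set). 1\<^sup>2 :: real) = 0"
      using orthonormal_parseval[OF orth, of "\<lambda>i::'v. 1"] by simp
    then show False by simp
  qed
  then obtain k0 where k0: "?one \<bullet> b k0 \<noteq> 0" by blast
  have "d k0 * (?one \<bullet> b k0) = 0"
    using symmetric_matrix_inner[OF sym, of ?one "b k0"] Lone eig[of k0] by simp
  then have dk0: "d k0 = 0" using k0 by simp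
  have const: "\<exists>c. b k = (\<chi> i. c)" if "d k = 0" for k
  proof -
    have "b k \<in> {u. L *v u = 0}" using that eig[of k] by simp
    then show ?thesis unfolding ker by blast
  qed
  have dpos: "d k > 0" if "k \<noteq> k0" for k
  proof (rule ccontr)
    assume "\<not> d k > 0"
    then have "d k = 0" using d0[of k] by simp
    then obtain c c' where "b k = (\<chi> i. c)" "b k0 = (\<chi> i. c')" using const dk0 by metis
    moreover from this have "c \<noteq> 0" "c' \<noteq> 0" using bn0[of k] bn0[of k0] by (auto simp: vec_eq_iff)
    moreover have "b k \<bullet> b k0 = 0" using that orth by simp
    ultimately show False by (simp add: inner_vec_def)
  qed
  define S where "S = image_mset d (mset_set (UNIV - {k0}))"
  have "proots (charpoly L) = (\<Sum>k\<in>UNIV. {#d k#})"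
    unfolding charpoly_eigenbasis[OF orth eig] by (subst proots_prod) auto
  also have "\<dots> = image_mset d (mset_set UNIV)"
    by (simp add: sum_unfold_sum_mset)
  also have "mset_set (UNIV :: 'v set) = add_mset k0 (mset_set (UNIV - {k0}))"
    by (metis UNIV_I finite mset_set.remove)
  finally have roots: "proots (charpoly L) = add_mset 0 S"
    by (simp add: S_def dk0)
  define l where "l = sorted_list_of_multiset S"
  have setl: "set l = d ` (UNIV - {k0})" by (simp add: l_def S_def)
  have sl: "sorted l" by (simp add: l_def)
  have lpos: "0 < x" if "x \<in> set l" for x
    using that dpos unfolding setl by auto
  then have "insort 0 l = 0 # l" by (cases l) (auto simp: less_imp_le)
  then have sorted: "sorted_list_of_multiset (proots (charpoly L)) = 0 # l"
    by (simp add: roots l_def)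
  have "length l = size S" unfolding l_def by (metis mset_sorted_list_of_multiset size_mset)
  then have len: "length l = CARD('v) - 1" by (simp add: S_def)
  then have "l \<noteq> []" using N by auto
  have small: "eigval L (CARD('v) - 1) = hd l"
    using len N \<open>l \<noteq> []\<close> by (auto simp: eigval_def sorted rev_nth nth_append hd_conv_nth)
  have big: "eigval L 1 = last l"
    using \<open>l \<noteq> []\<close> by (simp add: eigval_def sorted nth_append rev_nth last_conv_nth)
  have hd_le: "hd l \<le> x" if "x \<in> set l" for x
    using sl that \<open>l \<noteq> []\<close> by (cases l) auto
  have le_last: "x \<le> last l" if "x \<in> set l" for x
    using sl that \<open>l \<noteq> []\<close>
    by (auto simp: in_set_conv_nth last_conv_nth intro!: sorted_nth_mono)
  have "hd l \<in> set l" using \<open>l \<noteq> []\<close> by simp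
  then have "hd l > 0" by (rule lpos)
  show ?thesis
  proof (rule that[OF orth eig dk0])
    show "b k0 $ i = b k0 $ j" for i j using const[OF dk0] by auto
    show "eigval L (CARD('v) - 1) \<le> d k \<and> d k \<le> eigval L 1" if "k \<noteq> k0" for k
      unfolding small big using that setl hd_le le_last by blast
    show "0 < eigval L (CARD('v) - 1)" unfolding small by fact
    show "eigval L (CARD('v) - 1) \<le> eigval L 1"
      unfolding small big by (rule le_last) fact
  qed
qed

section \<open>Nesterov momentum on a scalar quadratic\<close>

text \<open>
  Along an eigenvector of the gossip matrix with \<open>a = 1 - \<eta> \<lambda>\<close>, a constant input 1 makes the
  iterate \<open>\<theta>\<^sub>t\<close> equal to \<open>damping \<zeta> a t\<close>: this is Nesterov's recursion for the quadratic with
  curvature \<open>\<lambda>\<close>.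
\<close>

fun damping :: "real \<Rightarrow> real \<Rightarrow> nat \<Rightarrow> real" where
  "damping \<zeta> a 0 = 1"
| "damping \<zeta> a (Suc 0) = (1 + \<zeta>) * a - \<zeta>"
| "damping \<zeta> a (Suc (Suc t)) = a * ((1 + \<zeta>) * damping \<zeta> a (Suc t) - \<zeta> * damping \<zeta> a t)"

lemma damping_one: "damping \<zeta> 1 t = 1"
  by (induction \<zeta> "1::real" t rule: damping.induct) auto

text \<open>
  With \<open>U\<close> the Chebyshev polynomials of the second kind, this is
  \<open>cos \<phi> ^ (t - 1) * U\<^sub>t\<^sub>-\<^sub>1 (cos \<phi>)\<close> for \<open>t > 0\<close>. The recursion avoids the quotient
  \<open>sin (t \<phi>) / sin \<phi>\<close>, which is undefined at the double root \<open>\<phi> = 0\<close>.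
\<close>

fun weighted_chebyshev :: "real \<Rightarrow> nat \<Rightarrow> real" where
  "weighted_chebyshev \<phi> 0 = 0"
| "weighted_chebyshev \<phi> (Suc t) = (cos \<phi>)\<^sup>2 * weighted_chebyshev \<phi> t + cos \<phi> ^ t * cos (t * \<phi>)"

lemma weighted_chebyshev_sin:
  "sin \<phi> * weighted_chebyshev \<phi> (Suc t) = cos \<phi> ^ t * sin (Suc t * \<phi>)" for \<phi> :: real
proof (induction t)
  case (Suc t)
  have "sin \<phi> * weighted_chebyshev \<phi> (Suc (Suc t))
      = (cos \<phi>)\<^sup>2 * (sin \<phi> * weighted_chebyshev \<phi> (Suc t)) + sin \<phi> * cos \<phi> ^ Suc t * cos (Suc t * \<phi>)"
    by (simp only: weighted_chebyshev.simps(2)[of \<phi> "Suc t"]) (simp add: algebra_simps)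
  also have "\<dots> = cos \<phi> ^ Suc t * (cos \<phi> * sin (Suc t * \<phi>) + sin \<phi> * cos (Suc t * \<phi>))"
    unfolding Suc.IH by (simp add: algebra_simps power2_eq_square)
  also have "cos \<phi> * sin (Suc t * \<phi>) + sin \<phi> * cos (Suc t * \<phi>) = sin (\<phi> + Suc t * \<phi>)"
    by (simp only: sin_add)
  also have "\<phi> + Suc t * \<phi> = Suc (Suc t) * \<phi>" by (simp add: algebra_simps)
  finally show ?case .
qed simp

text \<open>
  Consecutive differences are a Chebyshev polynomial of the first kind times a power of the cosine,
  hence bounded by 1. This cancellation saves the factor \<open>t\<close> that each of the two terms has
  separately.
\<close>

lemma weighted_chebyshev_diff:
  "weighted_chebyshev \<phi> (Suc (Suc t)) - weighted_chebyshev \<phi> (Suc t) = cos \<phi> ^ t * cos (Suc (Suc t) * \<phi>)"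
  for \<phi> :: real
proof -
  have "weighted_chebyshev \<phi> (Suc (Suc t)) - weighted_chebyshev \<phi> (Suc t)
      = ((cos \<phi>)\<^sup>2 - 1) * weighted_chebyshev \<phi> (Suc t) + cos \<phi> ^ Suc t * cos (Suc t * \<phi>)"
    by (simp only: weighted_chebyshev.simps(2)[of \<phi> "Suc t"]) (simp add: algebra_simps)
  also have "(cos \<phi>)\<^sup>2 - 1 = - (sin \<phi> * sin \<phi>)"
    using sin_cos_squared_add[of \<phi>] by (simp add: power2_eq_square algebra_simps)
  also have "- (sin \<phi> * sin \<phi>) * weighted_chebyshev \<phi> (Suc t) = - sin \<phi> * (sin \<phi> * weighted_chebyshev \<phi> (Suc t))"
    by (simp only: mult_minus_left mult.assoc)
  also have "\<dots> + cos \<phi> ^ Suc t * cos (Suc t * \<phi>)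
      = cos \<phi> ^ t * (cos \<phi> * cos (Suc t * \<phi>) - sin \<phi> * sin (Suc t * \<phi>))"
    unfolding weighted_chebyshev_sin by (simp add: algebra_simps)
  also have "cos \<phi> * cos (Suc t * \<phi>) - sin \<phi> * sin (Suc t * \<phi>) = cos (\<phi> + Suc t * \<phi>)"
    by (simp only: cos_add)
  also have "\<phi> + Suc t * \<phi> = Suc (Suc t) * \<phi>" by (simp add: algebra_simps)
  finally show ?thesis .
qed

lemma abs_power_cos_mult_cos_le: "\<bar>cos \<phi> ^ t * cos (x::real)\<bar> \<le> 1" for \<phi> :: real
  unfolding abs_mult power_abs by (intro mult_le_one power_le_one) auto

lemma abs_weighted_chebyshev_le: "\<bar>weighted_chebyshev \<phi> t\<bar> \<le> t"
proof (induction t)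
  case (Suc t)
  have "\<bar>(cos \<phi>)\<^sup>2 * weighted_chebyshev \<phi> t\<bar> \<le> 1 * \<bar>weighted_chebyshev \<phi> t\<bar>"
    unfolding abs_mult by (intro mult_right_mono) (auto simp: abs_square_le_1)
  with Suc abs_power_cos_mult_cos_le[of \<phi> t "t * \<phi>"] show ?case by simp
qed simp

text \<open>
  The characteristic roots of the recursion are complex conjugates on the whole range
  \<open>0 \<le> a \<le> 1 - q\<^sup>2\<close>. Writing \<open>a = (1 - q\<^sup>2) cos\<^sup>2 \<phi>\<close> their modulus is \<open>(1 - q) cos \<phi>\<close> and their
  argument \<open>\<phi>\<close>, so one angle describes both.
\<close>

lemma damping_weighted_chebyshev:
  assumes q: "0 < q" and \<zeta>: "\<zeta> = (1 - q) / (1 + q)" and a: "a = (1 - q\<^sup>2) * (cos \<phi>)\<^sup>2"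
  shows "damping \<zeta> a t
    = (1 - q) ^ t * (weighted_chebyshev \<phi> (Suc t) - weighted_chebyshev \<phi> t / (1 + q))"
  using \<zeta> a
proof (induction \<zeta> a t rule: damping.induct)
  case (1 \<zeta> a)
  then show ?case by simp
next
  case (2 \<zeta> a)
  have "(1 + \<zeta>) * a = 2 * (1 - q) * (cos \<phi>)\<^sup>2" "\<zeta> = (1 - q) * (1 / (1 + q))"
    using q unfolding 2 by (simp_all add: power2_eq_square divide_simps) (simp add: algebra_simps)
  moreover have "1 - 1 / (1 + q) = q / (1 + q)" using q by (simp add: field_simps)
  ultimately show ?case
    by (simp add: power2_eq_square algebra_simps)
next
  case (3 \<zeta> a t)
  note IH = 3(1)[OF 3(3,4)] 3(2)[OF 3(3,4)]
  let ?V = "weighted_chebyshev \<phi>" and ?c = "cos \<phi>"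
  have rec: "?V (Suc (Suc s)) = 2 * ?c\<^sup>2 * ?V (Suc s) - ?c\<^sup>2 * ?V s" for s
  proof (cases s)
    case 0
    then show ?thesis by (simp add: power2_eq_square)
  next
    case (Suc r)
    have "?V (Suc (Suc s)) - ?c\<^sup>2 * ?V (Suc s) = ?c ^ Suc s * cos (Suc s * \<phi>)"
      by (simp only: weighted_chebyshev.simps(2)[of \<phi> "Suc s"])
    also have "\<dots> = ?c\<^sup>2 * (?c ^ r * cos (Suc (Suc r) * \<phi>))"
      by (simp add: Suc power2_eq_square)
    also have "\<dots> = ?c\<^sup>2 * (?V (Suc s) - ?V s)"
      unfolding Suc weighted_chebyshev_diff ..
    finally show ?thesis by (simp add: algebra_simps)
  qed
  have q1: "1 + q \<noteq> 0" using q by simp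
  define U0 U1 U2 U3 where "U0 = ?V t" and "U1 = ?V (Suc t)" and "U2 = ?V (Suc (Suc t))"
    and "U3 = ?V (Suc (Suc (Suc t)))"
  have U3: "U3 = ?c\<^sup>2 * (2 * U2 - U1)" and U2: "U2 = ?c\<^sup>2 * (2 * U1 - U0)"
    unfolding U0_def U1_def U2_def U3_def rec[of "Suc t"] rec[of t] by (simp_all add: algebra_simps)
  have z1: "1 + \<zeta> = 2 / (1 + q)" using q1 by (simp add: 3(3) field_simps)
  have a\<zeta>: "a * (1 + \<zeta>) = 2 * (1 - q) * ?c\<^sup>2" "a * \<zeta> = (1 - q)\<^sup>2 * ?c\<^sup>2"
    unfolding z1 unfolding 3(3,4) using q1
    by (simp_all add: divide_simps) (simp_all add: power2_eq_square algebra_simps)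
  have "damping \<zeta> a (Suc (Suc t)) = a * (1 + \<zeta>) * damping \<zeta> a (Suc t) - a * \<zeta> * damping \<zeta> a t"
    by (simp add: algebra_simps)
  also have "\<dots> = (1 - q) ^ Suc (Suc t) * (?c\<^sup>2 * (2 * (U2 - U1 / (1 + q)) - (U1 - U0 / (1 + q))))"
    unfolding a\<zeta> IH U0_def[symmetric] U1_def[symmetric] U2_def[symmetric]
    by (simp add: power2_eq_square algebra_simps add_divide_distrib diff_divide_distrib)
  also have "?c\<^sup>2 * (2 * (U2 - U1 / (1 + q)) - (U1 - U0 / (1 + q))) = U3 - U2 / (1 + q)"
    unfolding U3 U2 by (simp add: diff_divide_distrib right_diff_distrib)
  finally show ?case by (simp only: U2_def U3_def)
qed

text \<open>
  With \<open>q = 1 / sqrt \<kappa>\<close> this is the left-hand side of the inequality that defines \<open>k_star \<kappa>\<close>.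
\<close>

definition damping_bound :: "real \<Rightarrow> nat \<Rightarrow> real" where
  "damping_bound q t = (1 + real t * q / (1 + q)) * (1 - q) ^ t"

text \<open>
  The bound is attained at \<open>a = 1 - q\<^sup>2\<close>, the mode of the smallest positive eigenvalue,
  where the two roots merge and the linear factor \<open>t\<close> appears. For the other values of \<open>a\<close>, the
  Chebyshev form of \<open>damping\<close> is a difference bounded by 1 plus \<open>q / (1 + q)\<close> times a term
  bounded by \<open>t\<close>.
\<close>

lemma abs_damping_le:
  assumes q: "0 < q" "q \<le> 1" and \<zeta>: "\<zeta> = (1 - q) / (1 + q)" and a: "0 \<le> a" "a \<le> 1 - q\<^sup>2"
  shows "\<bar>damping \<zeta> a t\<bar> \<le> damping_bound q t"
proof -
  obtain \<phi> where \<phi>: "a = (1 - q\<^sup>2) * (cos \<phi>)\<^sup>2"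
  proof (cases "q = 1")
    case True
    then show ?thesis using a that by simp
  next
    case False
    define c where "c = sqrt (a / (1 - q\<^sup>2))"
    have pos: "1 - q\<^sup>2 > 0" using False q by (simp add: abs_square_less_1)
    then have "0 \<le> a / (1 - q\<^sup>2)" "a / (1 - q\<^sup>2) \<le> 1" using a by simp_all
    then have "0 \<le> c" "c \<le> 1" "c\<^sup>2 = a / (1 - q\<^sup>2)" by (simp_all add: c_def)
    moreover from this have "cos (arccos c) = c" by simp
    ultimately have "a = (1 - q\<^sup>2) * (cos (arccos c))\<^sup>2" using pos by simp
    then show ?thesis by (rule that)
  qed
  let ?V = "weighted_chebyshev \<phi>"
  have "?V (Suc t) - ?V t / (1 + q) = (?V (Suc t) - ?V t) + q / (1 + q) * ?V t"
  proof -
    have "q / (1 + q) = 1 - 1 / (1 + q)" using q by (simp add: field_simps)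
    then show ?thesis by (simp add: left_diff_distrib del: weighted_chebyshev.simps)
  qed
  then have "\<bar>?V (Suc t) - ?V t / (1 + q)\<bar> \<le> \<bar>?V (Suc t) - ?V t\<bar> + \<bar>q / (1 + q) * ?V t\<bar>"
    by (simp only: abs_triangle_ineq)
  also have "\<bar>?V (Suc t) - ?V t\<bar> \<le> 1"
    using abs_power_cos_mult_cos_le weighted_chebyshev_diff[of \<phi>] by (cases t) auto
  also have "\<bar>q / (1 + q) * ?V t\<bar> \<le> q / (1 + q) * t"
    unfolding abs_mult using q abs_weighted_chebyshev_le[of \<phi> t] by (intro mult_mono) auto
  finally have "\<bar>?V (Suc t) - ?V t / (1 + q)\<bar> \<le> 1 + real t * q / (1 + q)"
    by (simp add: mult.commute)
  then have "(1 - q) ^ t * \<bar>?V (Suc t) - ?V t / (1 + q)\<bar> \<le> (1 - q) ^ t * (1 + real t * q / (1 + q))"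
    using q by (intro mult_left_mono) auto
  then show ?thesis
    unfolding damping_weighted_chebyshev[OF q(1) \<zeta> \<phi>] damping_bound_def abs_mult
    using q by (simp add: power_abs mult.commute[of "(1 - q) ^ t"])
qed

lemma damping_bound_nonneg: "0 < q \<Longrightarrow> q \<le> 1 \<Longrightarrow> 0 \<le> damping_bound q t"
  by (simp add: damping_bound_def)

text \<open>
  Bernoulli's inequality bounds the linear factor by \<open>(1 + q) ^ t\<close>, and
  \<open>(1 + q) * (1 - q) \<le> 1\<close>. This controls the iterations before \<open>k_star \<kappa>\<close>, where no exponential
  decay is available yet.
\<close>

lemma damping_bound_le_1:
  assumes q: "0 < q" "q \<le> 1"
  shows "damping_bound q t \<le> 1"
proof -
  have "1 + real t * q / (1 + q) \<le> 1 + real t * q"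
    using q mult_left_mono[of 1 "1 + q" "real t * q"] by (simp add: divide_le_eq)
  also have "\<dots> \<le> (1 + q) ^ t" using q by (intro Bernoulli_inequality) auto
  finally have "damping_bound q t \<le> (1 + q) ^ t * (1 - q) ^ t"
    unfolding damping_bound_def using q by (intro mult_right_mono) auto
  also have "\<dots> = ((1 + q) * (1 - q)) ^ t" by (simp add: power_mult_distrib)
  also have "\<dots> \<le> 1"
    using q mult_le_one[of q q] by (intro power_le_one) (auto simp: algebra_simps)
  finally show ?thesis .
qed

text \<open>
  The minimum defining \<open>k_star\<close> is attained: the quotient of the two sides is a linear function
  times the power of a number below 1, which tends to 0.
\<close>

lemma k_star_property:
  assumes \<kappa>: "1 \<le> \<kappa>" and q: "q = 1 / sqrt \<kappa>"
  shows "1 \<le> k_star \<kappa>" and "k_star \<kappa> \<le> m \<Longrightarrow> damping_bound q m \<le> (1 - q / 2) ^ m"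
proof -
  have q01: "0 < q" "q \<le> 1" using \<kappa> by (auto simp: q)
  have eq: "(1 + real m / (sqrt \<kappa> + 1)) * (1 - 1 / sqrt \<kappa>) ^ m = damping_bound q m"
    "(1 - 1 / (2 * sqrt \<kappa>)) ^ m = (1 - q / 2) ^ m" for m
  proof -
    have "q / (1 + q) = 1 / (sqrt \<kappa> + 1)" using \<kappa> by (simp add: q field_simps)
    then show "(1 + real m / (sqrt \<kappa> + 1)) * (1 - 1 / sqrt \<kappa>) ^ m = damping_bound q m"
      unfolding damping_bound_def times_divide_eq_right[symmetric] by (simp add: q)
  qed (simp add: q mult.commute)
  let ?P = "\<lambda>k. k \<ge> 1 \<and> (\<forall>m\<ge>k. damping_bound q m \<le> (1 - q / 2) ^ m)"
  define \<beta> where "\<beta> = (1 - q) / (1 - q / 2)"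
  have \<beta>: "0 \<le> \<beta>" "\<beta> < 1" using q01 by (auto simp: \<beta>_def field_simps)
  have "(\<lambda>m. \<beta> ^ m + q / (1 + q) * (real m * \<beta> ^ m)) \<longlonglongrightarrow> 0 + q / (1 + q) * 0"
    using \<beta> by (intro tendsto_intros LIMSEQ_power_zero powser_times_n_limit_0) auto
  then have "eventually (\<lambda>m. \<beta> ^ m + q / (1 + q) * (real m * \<beta> ^ m) < 1) sequentially"
    by (auto intro: order_tendstoD)
  then obtain k where k: "\<And>m. m \<ge> k \<Longrightarrow> \<beta> ^ m + q / (1 + q) * (real m * \<beta> ^ m) < 1"
    by (auto simp: eventually_sequentially)
  have "damping_bound q m \<le> (1 - q / 2) ^ m" if "m \<ge> k" for m
  proof -
    have "(1 - q) ^ m = \<beta> ^ m * (1 - q / 2) ^ m"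
      using q01 by (simp add: \<beta>_def flip: power_mult_distrib)
    then have "damping_bound q m = (\<beta> ^ m + q / (1 + q) * (real m * \<beta> ^ m)) * (1 - q / 2) ^ m"
      by (simp add: damping_bound_def algebra_simps)
    also have "\<dots> \<le> 1 * (1 - q / 2) ^ m"
      using k[OF that] q01 by (intro mult_right_mono) auto
    finally show ?thesis by simp
  qed
  then have "?P (max 1 k)" by auto
  then have "?P (k_star \<kappa>)"
    unfolding k_star_def eq by (rule LeastI)
  then show "1 \<le> k_star \<kappa>" "k_star \<kappa> \<le> m \<Longrightarrow> damping_bound q m \<le> (1 - q / 2) ^ m"
    by auto
qed

lemma sum_atLeastLessThan_power_le:
  assumes "0 \<le> x" "x < (1::real)"
  shows "(\<Sum>t = m..<n. x ^ t) \<le> x ^ m / (1 - x)"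
proof (cases "m \<le> n")
  case True
  then have "(1 - x) * (\<Sum>t = m..<n. x ^ t) = x ^ m - x ^ n"
    by (induction n rule: dec_induct) (simp_all add: distrib_left, simp_all add: algebra_simps)
  also have "\<dots> \<le> x ^ m" using assms by simp
  finally show ?thesis using assms by (simp add: pos_le_divide_eq mult.commute)
qed (use assms in auto)

text \<open>
  The first \<open>k_star \<kappa>\<close> terms are at most 1 each; the others are dominated by a geometric series
  with ratio \<open>(1 - q / 2)\<^sup>2 \<le> 1 - 3 q / 4\<close>.
\<close>

lemma sum_damping_bound_squares_le:
  assumes \<kappa>: "1 \<le> \<kappa>" and q: "q = 1 / sqrt \<kappa>"
  shows "(\<Sum>t<n. (damping_bound q t)\<^sup>2) \<le> k_star \<kappa> + 4 / 3 * sqrt \<kappa>"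
proof -
  have q01: "0 < q" "q \<le> 1" using \<kappa> by (auto simp: q)
  let ?h = "damping_bound q" and ?k = "k_star \<kappa>" and ?x = "(1 - q / 2)\<^sup>2"
  have x: "?x = 1 - (q - q\<^sup>2 / 4)" by (simp add: power2_eq_square algebra_simps)
  have x1: "q - q\<^sup>2 / 4 \<le> 1" using q01 zero_le_power2[of q] by linarith
  have q2: "q\<^sup>2 \<le> q" using q01 by (simp add: power2_eq_square mult_le_one)
  have h: "0 \<le> ?h t" for t using q01 by (rule damping_bound_nonneg)
  have "(\<Sum>t<n. (?h t)\<^sup>2) \<le> (\<Sum>t<?k + n. (?h t)\<^sup>2)"
    by (intro sum_mono2) auto
  also have "\<dots> = (\<Sum>t<?k. (?h t)\<^sup>2) + (\<Sum>t = ?k..<?k + n. (?h t)\<^sup>2)"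
    by (simp add: lessThan_atLeast0 sum.atLeastLessThan_concat)
  also have "(\<Sum>t<?k. (?h t)\<^sup>2) \<le> (\<Sum>t<?k. 1)"
    using h damping_bound_le_1[OF q01] by (intro sum_mono power_le_one) auto
  also have "(\<Sum>t = ?k..<?k + n. (?h t)\<^sup>2) \<le> (\<Sum>t = ?k..<?k + n. ?x ^ t)"
  proof (intro sum_mono)
    fix t assume "t \<in> {?k..<?k + n}"
    then have "(?h t)\<^sup>2 \<le> ((1 - q / 2) ^ t)\<^sup>2"
      using k_star_property(2)[OF \<kappa> q] h by (intro power_mono) auto
    then show "(?h t)\<^sup>2 \<le> ?x ^ t" by (simp add: power_mult[symmetric] mult.commute)
  qed
  also have "\<dots> \<le> ?x ^ ?k / (1 - ?x)"
    using q01 q2 x1 by (intro sum_atLeastLessThan_power_le) (auto simp: x)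
  also have "\<dots> \<le> 1 / (3 / 4 * q)"
    using q01 q2 x1 by (intro frac_le power_le_one) (auto simp: x)
  also have "\<dots> = 4 / 3 * sqrt \<kappa>" by (simp add: q)
  finally show ?thesis by simp
qed

text \<open>
  The total weight with which the input at time \<open>s\<close> enters \<open>\<theta>\<^sub>t\<close> summed over \<open>T0 \<le> t < T\<close>: the
  partial sums of the iterates up to \<open>T\<close> and up to \<open>T0\<close> are both convolutions of the input with
  \<open>damping\<close>, see \<open>sum_momentum_iterates\<close>.
\<close>

definition tail_weight :: "real \<Rightarrow> real \<Rightarrow> nat \<Rightarrow> nat \<Rightarrow> nat \<Rightarrow> real" where
  "tail_weight \<zeta> a T0 T s = damping \<zeta> a (T - Suc s) - (if s < T0 then damping \<zeta> a (T0 - Suc s) else 0)"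

text \<open>
  Both sides are the response to a constant input 1, summed over the output window.
\<close>

lemma sum_tail_weight:
  assumes "T0 \<le> T"
  shows "(\<Sum>s<T. tail_weight \<zeta> a T0 T s) = (\<Sum>t = T0..<T. damping \<zeta> a t)"
proof -
  have "(\<Sum>s<T. if s < T0 then damping \<zeta> a (T0 - Suc s) else 0) = (\<Sum>s<T0. damping \<zeta> a (T0 - Suc s))"
    using assms by (intro sum.mono_neutral_cong_right) auto
  then have "(\<Sum>s<T. tail_weight \<zeta> a T0 T s) = (\<Sum>t<T. damping \<zeta> a t) - (\<Sum>t<T0. damping \<zeta> a t)"
    by (simp add: tail_weight_def sum_subtractf sum.nat_diff_reindex)
  also have "(\<Sum>t<T. damping \<zeta> a t) = (\<Sum>t<T0. damping \<zeta> a t) + (\<Sum>t = T0..<T. damping \<zeta> a t)"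
    using assms by (simp add: lessThan_atLeast0 sum.atLeastLessThan_concat)
  finally show ?thesis by simp
qed

lemma sum_tail_weight_one_squares:
  assumes "T0 \<le> T"
  shows "(\<Sum>s<T. (tail_weight \<zeta> 1 T0 T s)\<^sup>2) = T - T0"
proof -
  have "(\<Sum>s<T. (tail_weight \<zeta> 1 T0 T s)\<^sup>2) = (\<Sum>s = T0..<T. 1)"
    by (rule sum.mono_neutral_cong_right) (auto simp: tail_weight_def damping_one)
  then show ?thesis using assms by simp
qed

lemma abs_sum_tail_weight_le:
  assumes \<kappa>: "1 \<le> \<kappa>" and q: "q = 1 / sqrt \<kappa>" and \<zeta>: "\<zeta> = (1 - q) / (1 + q)"
    and a: "0 \<le> a" "a \<le> 1 - q\<^sup>2" and T0: "k_star \<kappa> \<le> T0" "T0 \<le> T"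
  shows "\<bar>\<Sum>s<T. tail_weight \<zeta> a T0 T s\<bar> \<le> 2 * sqrt \<kappa> * (1 - q / 2) ^ T0"
proof -
  have q01: "0 < q" "q \<le> 1" using \<kappa> by (auto simp: q)
  have "\<bar>\<Sum>s<T. tail_weight \<zeta> a T0 T s\<bar> \<le> (\<Sum>t = T0..<T. \<bar>damping \<zeta> a t\<bar>)"
    unfolding sum_tail_weight[OF T0(2)] by (rule sum_abs)
  also have "\<dots> \<le> (\<Sum>t = T0..<T. (1 - q / 2) ^ t)"
    using T0 abs_damping_le[OF q01 \<zeta> a] k_star_property(2)[OF \<kappa> q]
    by (intro sum_mono) (auto intro: order_trans)
  also have "\<dots> \<le> (1 - q / 2) ^ T0 / (1 - (1 - q / 2))"
    using q01 by (intro sum_atLeastLessThan_power_le) auto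
  also have "\<dots> = 2 * sqrt \<kappa> * (1 - q / 2) ^ T0" by (simp add: q)
  finally show ?thesis .
qed

text \<open>
  Every index \<open>t < T0\<close> of \<open>damping\<close> is used once by an input inside the window and once by an
  input before it; there the square of the difference costs another factor 2. So the sum is at most
  three times the sum of all squares.
\<close>

lemma sum_tail_weight_squares_le:
  assumes \<kappa>: "1 \<le> \<kappa>" and q: "q = 1 / sqrt \<kappa>" and \<zeta>: "\<zeta> = (1 - q) / (1 + q)"
    and a: "0 \<le> a" "a \<le> 1 - q\<^sup>2"
  shows "(\<Sum>s<2 * T0. (tail_weight \<zeta> a T0 (2 * T0) s)\<^sup>2) \<le> 6 * (k_star \<kappa> + sqrt \<kappa>)"
proof -
  have q01: "0 < q" "q \<le> 1" using \<kappa> by (auto simp: q)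
  let ?h = "damping_bound q" and ?w = "tail_weight \<zeta> a T0 (2 * T0)" and ?e = "damping \<zeta> a"
  have e: "(?e t)\<^sup>2 \<le> (?h t)\<^sup>2" for t
    using abs_damping_le[OF q01 \<zeta> a, of t] by (simp add: abs_le_square_iff[symmetric] damping_bound_nonneg[OF q01])
  have "(\<Sum>s<2 * T0. (?w s)\<^sup>2) = (\<Sum>s<T0. (?w s)\<^sup>2) + (\<Sum>s = T0..<2 * T0. (?w s)\<^sup>2)"
    by (simp add: lessThan_atLeast0 sum.atLeastLessThan_concat)
  also have "(\<Sum>s = T0..<2 * T0. (?w s)\<^sup>2) = (\<Sum>s<T0. (?e (T0 - Suc s))\<^sup>2)"
    by (rule sum.reindex_bij_witness[of _ "\<lambda>s. s + T0" "\<lambda>s. s - T0"]) (auto simp: tail_weight_def mult_2)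
  also have "\<dots> = (\<Sum>t<T0. (?e t)\<^sup>2)" by (rule sum.nat_diff_reindex)
  also have "(\<Sum>s<T0. (?w s)\<^sup>2) \<le> (\<Sum>s<T0. 2 * (?e (T0 - Suc s + T0))\<^sup>2 + 2 * (?e (T0 - Suc s))\<^sup>2)"
  proof (intro sum_mono)
    fix s assume "s \<in> {..<T0}"
    then have "2 * T0 - Suc s = T0 - Suc s + T0" by simp
    moreover have "(x - y)\<^sup>2 \<le> 2 * x\<^sup>2 + 2 * y\<^sup>2" for x y :: real
      using zero_le_power2[of "x + y"] by (simp add: power2_eq_square algebra_simps)
    ultimately show "(?w s)\<^sup>2 \<le> 2 * (?e (T0 - Suc s + T0))\<^sup>2 + 2 * (?e (T0 - Suc s))\<^sup>2"
      using \<open>s \<in> _\<close> by (simp add: tail_weight_def)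
  qed
  also have "\<dots> = (\<Sum>t<T0. 2 * (?e (t + T0))\<^sup>2 + 2 * (?e t)\<^sup>2)" by (rule sum.nat_diff_reindex)
  also have "\<dots> + (\<Sum>t<T0. (?e t)\<^sup>2) = 3 * (\<Sum>t<T0. (?e t)\<^sup>2) + 2 * (\<Sum>t<T0. (?e (t + T0))\<^sup>2)"
    by (simp add: sum.distrib flip: sum_distrib_left)
  also have "\<dots> \<le> 3 * (\<Sum>t<T0. (?h t)\<^sup>2) + 3 * (\<Sum>t<T0. (?h (t + T0))\<^sup>2)"
    using e by (intro add_mono mult_mono sum_mono sum_nonneg) auto
  also have "(\<Sum>t<T0. (?h (t + T0))\<^sup>2) = (\<Sum>t = T0..<2 * T0. (?h t)\<^sup>2)"
    by (rule sum.reindex_bij_witness[of _ "\<lambda>s. s - T0" "\<lambda>s. s + T0"]) auto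
  also have "3 * (\<Sum>t<T0. (?h t)\<^sup>2) + 3 * (\<Sum>t = T0..<2 * T0. (?h t)\<^sup>2) = 3 * (\<Sum>t<2 * T0. (?h t)\<^sup>2)"
    by (simp add: lessThan_atLeast0 sum.atLeastLessThan_concat flip: distrib_left)
  also have "\<dots> \<le> 3 * (k_star \<kappa> + 4 / 3 * sqrt \<kappa>)"
    using sum_damping_bound_squares_le[OF \<kappa> q, of "2 * T0"] by simp
  also have "\<dots> \<le> 6 * (k_star \<kappa> + sqrt \<kappa>)" using \<kappa> by simp
  finally show ?thesis by simp
qed

section \<open>The algorithm in spectral coordinates\<close>

text \<open>
  Summing the two update rules over time shows that the partial sums of \<open>x + r\<close> obey the recursion
  of \<open>damping\<close> with forcing term \<open>r (Suc t) - \<zeta> * r t\<close>, and the convolution obeys the same one. The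
  individual iterates would involve differences of \<open>damping\<close>; passing to partial sums, which are what
  the output averages, makes the kernel \<open>damping\<close> itself.
\<close>

lemma sum_momentum_iterates:
  fixes x y r :: "nat \<Rightarrow> real"
  assumes init: "x 0 = 0" "y 0 = 0"
    and y: "\<And>t. y (Suc t) = x t - (1 - a) * (x t + r t)"
    and x: "\<And>t. x (Suc t) = y (Suc t) + \<zeta> * (y (Suc t) - y t)"
  shows "(\<Sum>\<tau><t. x \<tau> + r \<tau>) = (\<Sum>s<t. damping \<zeta> a (t - Suc s) * r s)"
proof -
  define \<Theta> where "\<Theta> t = (\<Sum>\<tau><t. x \<tau> + r \<tau>)" for t
  define F where "F t = (\<Sum>s<t. damping \<zeta> a (t - Suc s) * r s)" for t
  have sum_y: "(\<Sum>\<tau><Suc t. y \<tau>) = a * \<Theta> t - (\<Sum>\<tau><t. r \<tau>)" for t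
    by (induction t) (simp_all add: init y \<Theta>_def algebra_simps)
  have sum_x: "(\<Sum>\<tau><Suc t. x \<tau>) = (1 + \<zeta>) * (\<Sum>\<tau><Suc t. y \<tau>) - \<zeta> * (\<Sum>\<tau><t. y \<tau>)" for t
    by (induction t) (simp_all add: init x algebra_simps)
  have \<Theta>_rec: "\<Theta> (Suc (Suc t)) = a * ((1 + \<zeta>) * \<Theta> (Suc t) - \<zeta> * \<Theta> t) + r (Suc t) - \<zeta> * r t" for t
  proof -
    have "\<Theta> (Suc (Suc t)) = (\<Sum>\<tau><Suc (Suc t). x \<tau>) + (\<Sum>\<tau><Suc (Suc t). r \<tau>)"
      unfolding \<Theta>_def by (rule sum.distrib)
    also have "\<dots> = (1 + \<zeta>) * (a * \<Theta> (Suc t) - (\<Sum>\<tau><Suc t. r \<tau>))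
        - \<zeta> * (a * \<Theta> t - (\<Sum>\<tau><t. r \<tau>)) + (\<Sum>\<tau><Suc (Suc t). r \<tau>)"
      unfolding sum_x[of "Suc t"] sum_y ..
    also have "\<dots> = a * ((1 + \<zeta>) * \<Theta> (Suc t) - \<zeta> * \<Theta> t) + r (Suc t) - \<zeta> * r t"
      by (simp add: algebra_simps)
    finally show ?thesis .
  qed
  have F_rec: "F (Suc (Suc t)) = a * ((1 + \<zeta>) * F (Suc t) - \<zeta> * F t) + r (Suc t) - \<zeta> * r t" for t
  proof -
    have "(\<Sum>s<t. damping \<zeta> a (Suc (Suc t) - Suc s) * r s)
        = (\<Sum>s<t. a * ((1 + \<zeta>) * (damping \<zeta> a (Suc t - Suc s) * r s) - \<zeta> * (damping \<zeta> a (t - Suc s) * r s)))"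
    proof (rule sum.cong[OF refl])
      fix s assume "s \<in> {..<t}"
      then obtain u where "t = Suc (s + u)" by (auto simp: less_iff_Suc_add)
      then have "Suc (Suc t) - Suc s = Suc (Suc u)" "Suc t - Suc s = Suc u" "t - Suc s = u" by auto
      then show "damping \<zeta> a (Suc (Suc t) - Suc s) * r s
        = a * ((1 + \<zeta>) * (damping \<zeta> a (Suc t - Suc s) * r s) - \<zeta> * (damping \<zeta> a (t - Suc s) * r s))"
        by (simp only: damping.simps(3)) (simp add: algebra_simps)
    qed
    also have "\<dots> = a * ((1 + \<zeta>) * (\<Sum>s<t. damping \<zeta> a (Suc t - Suc s) * r s) - \<zeta> * F t)"
      by (simp add: F_def sum_distrib_left sum_subtractf right_diff_distrib)
    finally show ?thesis by (simp add: F_def algebra_simps)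
  qed
  have "\<Theta> t = F t \<and> \<Theta> (Suc t) = F (Suc t)"
    by (induction t) (simp_all add: \<Theta>_rec F_rec, simp_all add: \<Theta>_def F_def init)
  then show ?thesis by (simp add: \<Theta>_def F_def)
qed

text \<open>
  The neighbourhood sum is the full matrix product because the other entries of \<open>L\<close> vanish, and by
  symmetry the eigenvector can be moved to the left of \<open>L\<close>.
\<close>

lemma gossip_step_eigenvector:
  fixes L :: "real^'v^'v"
  assumes L: "gossip_matrix E L" and b: "L *v b = d *\<^sub>R b"
  shows "(\<Sum>i\<in>UNIV. b $ i * (\<Sum>l\<in>nbrs E i \<union> {i}. L $ i $ l *\<^sub>R (z l :: real^'n)) $ j)
    = d * (\<Sum>i\<in>UNIV. b $ i * z i $ j)"
proof -
  have nb: "(\<Sum>l\<in>nbrs E i \<union> {i}. L $ i $ l *\<^sub>R z l) = (\<Sum>l\<in>UNIV. L $ i $ l *\<^sub>R z l)" for i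
    using L by (intro sum.mono_neutral_left) (auto simp: gossip_matrix_def nbrs_def)
  have "transpose L = L" using L by (simp add: gossip_matrix_def)
  then have sym: "L $ i $ l = L $ l $ i" for i l
    by (metis transpose_def vec_lambda_beta)
  have ev: "(\<Sum>i\<in>UNIV. L $ l $ i * b $ i) = d * b $ l" for l
    using arg_cong[OF b, of "\<lambda>x. x $ l"] by (simp add: matrix_vector_mult_def)
  have "(\<Sum>i\<in>UNIV. b $ i * (\<Sum>l\<in>UNIV. L $ i $ l *\<^sub>R z l) $ j)
      = (\<Sum>i\<in>UNIV. \<Sum>l\<in>UNIV. (L $ l $ i * b $ i) * z l $ j)"
    by (simp add: sum_distrib_left sym mult_ac)
  also have "\<dots> = (\<Sum>l\<in>UNIV. (\<Sum>i\<in>UNIV. L $ l $ i * b $ i) * z l $ j)"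
    by (subst sum.swap) (simp add: sum_distrib_right)
  finally show ?thesis unfolding nb ev by (simp add: sum_distrib_left mult.assoc)
qed

text \<open>
  Projecting the node values on an eigenvector decouples the algorithm into one scalar momentum
  recursion for each eigenvector and each component.
\<close>

lemma sda_output_eigenvector:
  fixes L :: "real^'v^'v" and r :: "'v \<Rightarrow> nat \<Rightarrow> real^'n"
  assumes L: "gossip_matrix E L" and b: "L *v b = d *\<^sub>R b" and T: "T0 \<le> T"
  shows "(\<Sum>i\<in>UNIV. b $ i * sda_output E L \<eta> \<zeta> T T0 r i $ j)
    = (1 / (real T - real T0)) *
      (\<Sum>s<T. tail_weight \<zeta> (1 - \<eta> * d) T0 T s * (\<Sum>i\<in>UNIV. b $ i * r i s $ j))"
proof -
  define P where "P f = (\<Sum>i\<in>UNIV. b $ i * f i $ j)" for f :: "'v \<Rightarrow> real^'n"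
  have P_add: "P (\<lambda>i. f i + g i) = P f + P g" and P_diff: "P (\<lambda>i. f i - g i) = P f - P g"
    and P_scale: "P (\<lambda>i. c *\<^sub>R f i) = c * P f" for f g c
    by (simp_all add: P_def sum.distrib sum_subtractf sum_distrib_left algebra_simps)
  have P_sum: "P (\<lambda>i. \<Sum>t\<in>A. f t i) = (\<Sum>t\<in>A. P (f t))" for A :: "nat set" and f
    unfolding P_def by (subst sum.swap) (simp add: sum_distrib_left)
  have P_L: "P (\<lambda>i. \<Sum>l\<in>nbrs E i \<union> {i}. L $ i $ l *\<^sub>R z l) = d * P z" for z
    unfolding P_def by (rule gossip_step_eigenvector[OF L b])
  define x y \<rho> where "x t = P (sda_x E L \<eta> \<zeta> r t)" and "y t = P (sda_y E L \<eta> \<zeta> r t)"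
    and "\<rho> t = P (\<lambda>i. r i t)" for t
  let ?a = "1 - \<eta> * d"
  have partial: "(\<Sum>\<tau><t. x \<tau> + \<rho> \<tau>) = (\<Sum>s<t. damping \<zeta> ?a (t - Suc s) * \<rho> s)" for t
  proof (rule sum_momentum_iterates)
    show "x 0 = 0" "y 0 = 0" by (simp_all add: x_def y_def P_def)
    show "y (Suc t) = x t - (1 - ?a) * (x t + \<rho> t)" for t
    proof -
      have "y (Suc t) = P (\<lambda>i. sda_y E L \<eta> \<zeta> r (Suc t) i)" unfolding y_def ..
      then show ?thesis
        unfolding sda_y.simps P_diff P_scale P_L by (simp add: P_add x_def \<rho>_def)
    qed
    show "x (Suc t) = y (Suc t) + \<zeta> * (y (Suc t) - y t)" for t
    proof -
      have "x (Suc t) = P (\<lambda>i. sda_x E L \<eta> \<zeta> r (Suc t) i)" unfolding x_def ..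
      then show ?thesis
        unfolding sda_x.simps P_add P_diff P_scale by (simp only: y_def)
    qed
  qed
  have "P (sda_output E L \<eta> \<zeta> T T0 r) = (1 / (real T - real T0)) * (\<Sum>t = T0..<T. x t + \<rho> t)"
    unfolding sda_output_def[abs_def] sda_theta_def P_scale P_sum P_add by (simp add: x_def \<rho>_def)
  also have "(\<Sum>t = T0..<T. x t + \<rho> t) = (\<Sum>t<T. x t + \<rho> t) - (\<Sum>t<T0. x t + \<rho> t)"
    using T by (simp add: lessThan_atLeast0 sum_diff_nat_ivl)
  also have "\<dots> = (\<Sum>s<T. damping \<zeta> ?a (T - Suc s) * \<rho> s)
      - (\<Sum>s<T. if s < T0 then damping \<zeta> ?a (T0 - Suc s) * \<rho> s else 0)"
    unfolding partial using T
    by (intro arg_cong2[where f = minus] refl sum.mono_neutral_cong_left) auto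
  also have "\<dots> = (\<Sum>s<T. tail_weight \<zeta> ?a T0 T s * \<rho> s)"
    unfolding sum_subtractf[symmetric]
    by (rule sum.cong) (simp_all add: tail_weight_def left_diff_distrib)
  finally show ?thesis by (simp add: P_def \<rho>_def)
qed

section \<open>Second moments of linear combinations of independent observations\<close>

lemma (in prob_space) second_moment_sum_indep_centered:
  fixes Y :: "'i \<Rightarrow> 'a \<Rightarrow> real"
  assumes "finite I" and "indep_vars (\<lambda>_. borel) Y I"
    and "\<And>i. i \<in> I \<Longrightarrow> integrable M (Y i)" and "\<And>i. i \<in> I \<Longrightarrow> expectation (Y i) = 0"
    and "\<And>i. i \<in> I \<Longrightarrow> integrable M (\<lambda>\<omega>. (Y i \<omega>)\<^sup>2)"
  shows "integrable M (\<lambda>\<omega>. (\<Sum>i\<in>I. Y i \<omega>)\<^sup>2) \<and>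
    expectation (\<lambda>\<omega>. (\<Sum>i\<in>I. Y i \<omega>)\<^sup>2) = (\<Sum>i\<in>I. expectation (\<lambda>\<omega>. (Y i \<omega>)\<^sup>2))"
  using assms
proof (induction I rule: finite_induct)
  case (insert i I)
  let ?S = "\<lambda>\<omega>. \<Sum>i\<in>I. Y i \<omega>"
  have IH: "integrable M (\<lambda>\<omega>. (?S \<omega>)\<^sup>2)"
    "expectation (\<lambda>\<omega>. (?S \<omega>)\<^sup>2) = (\<Sum>i\<in>I. expectation (\<lambda>\<omega>. (Y i \<omega>)\<^sup>2))"
    using insert.IH insert.prems indep_vars_subset[OF insert.prems(1), of I] by auto
  have ind: "indep_var borel (Y i) borel ?S"
    using insert by (intro indep_vars_sum) auto
  have int: "integrable M (Y i)" "integrable M ?S" using insert.prems by auto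
  have cross: "integrable M (\<lambda>\<omega>. Y i \<omega> * ?S \<omega>)" "expectation (\<lambda>\<omega>. Y i \<omega> * ?S \<omega>) = 0"
    using indep_var_integrable[OF ind int] indep_var_lebesgue_integral[OF ind int] insert.prems(3)
    by simp_all
  have eq: "(\<Sum>k\<in>insert i I. Y k \<omega>)\<^sup>2 = (Y i \<omega>)\<^sup>2 + (2 * (Y i \<omega> * ?S \<omega>) + (?S \<omega>)\<^sup>2)" for \<omega>
    using insert.hyps by (simp add: power2_eq_square algebra_simps)
  have "integrable M (\<lambda>\<omega>. (Y i \<omega>)\<^sup>2)" using insert.prems by simp
  then show ?case unfolding eq using IH cross insert.hyps by simp
qed simp

text \<open>
  The decomposition into squared bias and variance; the noise terms are orthogonal in \<open>L\<^sup>2\<close> by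
  independence.
\<close>

lemma (in prob_space) second_moment_linear_combination_indep:
  fixes X :: "'i \<Rightarrow> 'a \<Rightarrow> real"
  assumes I: "finite I" and ind: "indep_vars (\<lambda>_. borel) X I"
    and int: "\<And>i. i \<in> I \<Longrightarrow> integrable M (X i)"
    and sq: "\<And>i. i \<in> I \<Longrightarrow> integrable M (\<lambda>\<omega>. (X i \<omega> - expectation (X i))\<^sup>2)"
  shows "integrable M (\<lambda>\<omega>. ((\<Sum>i\<in>I. c i * X i \<omega>) - m)\<^sup>2)"
    and "expectation (\<lambda>\<omega>. ((\<Sum>i\<in>I. c i * X i \<omega>) - m)\<^sup>2)
      = ((\<Sum>i\<in>I. c i * expectation (X i)) - m)\<^sup>2 + (\<Sum>i\<in>I. (c i)\<^sup>2 * variance (X i))"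
proof -
  define Y where "Y i \<omega> = c i * (X i \<omega> - expectation (X i))" for i \<omega>
  define \<beta> where "\<beta> = (\<Sum>i\<in>I. c i * expectation (X i)) - m"
  have indY: "indep_vars (\<lambda>_. borel) Y I"
    unfolding Y_def by (rule indep_vars_compose2[OF ind]) simp
  have intY: "integrable M (Y i)" and zero: "expectation (Y i) = 0"
    and sqY: "integrable M (\<lambda>\<omega>. (Y i \<omega>)\<^sup>2)" if "i \<in> I" for i
    using int[OF that] sq[OF that] by (simp_all add: Y_def[abs_def] power_mult_distrib prob_space)
  let ?S = "\<lambda>\<omega>. \<Sum>i\<in>I. Y i \<omega>"
  have S2: "integrable M (\<lambda>\<omega>. (?S \<omega>)\<^sup>2)"
    "expectation (\<lambda>\<omega>. (?S \<omega>)\<^sup>2) = (\<Sum>i\<in>I. expectation (\<lambda>\<omega>. (Y i \<omega>)\<^sup>2))"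
    using second_moment_sum_indep_centered[OF I indY intY zero sqY] by auto
  have S1: "integrable M ?S" "expectation ?S = 0"
    using intY zero by (auto simp: Bochner_Integration.integral_sum)
  have eq: "((\<Sum>i\<in>I. c i * X i \<omega>) - m)\<^sup>2 = (?S \<omega>)\<^sup>2 + (2 * \<beta> * ?S \<omega> + \<beta>\<^sup>2)" for \<omega>
  proof -
    have "(\<Sum>i\<in>I. c i * X i \<omega>) - m = ?S \<omega> + \<beta>"
      by (simp add: Y_def \<beta>_def sum_subtractf right_diff_distrib)
    then show ?thesis by (simp add: power2_sum)
  qed
  show "integrable M (\<lambda>\<omega>. ((\<Sum>i\<in>I. c i * X i \<omega>) - m)\<^sup>2)"
    unfolding eq using S1 S2 by simp
  show "expectation (\<lambda>\<omega>. ((\<Sum>i\<in>I. c i * X i \<omega>) - m)\<^sup>2)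
      = ((\<Sum>i\<in>I. c i * expectation (X i)) - m)\<^sup>2 + (\<Sum>i\<in>I. (c i)\<^sup>2 * variance (X i))"
    unfolding eq using S1 S2 by (simp add: prob_space Y_def power_mult_distrib \<beta>_def)
qed

lemma (in prob_space) observations_component:
  assumes "observations R \<mu> \<Sigma>"
  shows "integrable M (\<lambda>\<omega>. R i t \<omega> $ j)" "expectation (\<lambda>\<omega>. R i t \<omega> $ j) = \<mu> i $ j"
    "integrable M (\<lambda>\<omega>. (R i t \<omega> $ j - \<mu> i $ j)\<^sup>2)"
    "expectation (\<lambda>\<omega>. (R i t \<omega> $ j - \<mu> i $ j)\<^sup>2) = \<Sigma> i $ j $ j"
proof -
  have m: "integrable M (R i t)" "expectation (R i t) = \<mu> i" and cov: "has_covariance (R i t) (\<Sigma> i)"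
    using assms by (auto simp: observations_def has_mean_def)
  show "integrable M (\<lambda>\<omega>. R i t \<omega> $ j)" "expectation (\<lambda>\<omega>. R i t \<omega> $ j) = \<mu> i $ j"
    using integrable_bounded_linear[OF bounded_linear_vec_nth m(1)]
      integral_bounded_linear[OF bounded_linear_vec_nth m(1)] m(2) by auto
  show "integrable M (\<lambda>\<omega>. (R i t \<omega> $ j - \<mu> i $ j)\<^sup>2)"
    "expectation (\<lambda>\<omega>. (R i t \<omega> $ j - \<mu> i $ j)\<^sup>2) = \<Sigma> i $ j $ j"
    using cov m(2) by (auto simp: has_covariance_def power2_eq_square)
qed

text \<open>
  One component of the output in one eigendirection has this form: a separable combination of all
  scalar observations, over nodes and times.
\<close>

lemma (in prob_space) observations_second_moment:
  fixes R :: "'v::finite \<Rightarrow> nat \<Rightarrow> 'a \<Rightarrow> real^'n"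
  assumes obs: "observations R \<mu> \<Sigma>"
  assumes Z: "Z = (\<lambda>\<omega>. (\<Sum>s<T. w s * (\<Sum>i\<in>UNIV. b i * R i s \<omega> $ j)) - m)"
  shows "integrable M (\<lambda>\<omega>. (Z \<omega>)\<^sup>2)"
    and "expectation (\<lambda>\<omega>. (Z \<omega>)\<^sup>2) = ((\<Sum>s<T. w s) * (\<Sum>i\<in>UNIV. b i * \<mu> i $ j) - m)\<^sup>2
      + (\<Sum>s<T. (w s)\<^sup>2) * (\<Sum>i\<in>UNIV. (b i)\<^sup>2 * \<Sigma> i $ j $ j)"
proof -
  let ?I = "(UNIV :: 'v set) \<times> {..<T}"
  define X where "X = (\<lambda>(i, t) \<omega>. R i t \<omega> $ j)"
  define c where "c = (\<lambda>(i, t). w t * b i)"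
  have "indep_vars (\<lambda>_. borel) (\<lambda>p \<omega>. (case p of (i, t) \<Rightarrow> R i t) \<omega> $ j) UNIV"
    using obs unfolding observations_def
    by (intro indep_vars_compose2[where Y = "\<lambda>_ x. x $ j"]) (auto intro!: borel_measurable_continuous_onI continuous_intros)
  also have "(\<lambda>p \<omega>. (case p of (i, t) \<Rightarrow> R i t) \<omega> $ j) = X"
    by (auto simp: X_def fun_eq_iff)
  finally have ind: "indep_vars (\<lambda>_. borel) X ?I"
    by (rule indep_vars_subset) simp
  have int: "integrable M (X p)" and sq: "integrable M (\<lambda>\<omega>. (X p \<omega> - expectation (X p))\<^sup>2)" for p
    using observations_component[OF obs] by (auto simp: X_def split: prod.splits)
  have Z': "Z = (\<lambda>\<omega>. (\<Sum>p\<in>?I. c p * X p \<omega>) - m)"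
    unfolding Z by (rule ext, subst sum.cartesian_product', subst sum.swap)
      (simp add: c_def X_def sum_distrib_left mult.assoc)
  show "integrable M (\<lambda>\<omega>. (Z \<omega>)\<^sup>2)"
    unfolding Z' by (rule second_moment_linear_combination_indep[OF _ ind int sq]) simp
  have "expectation (\<lambda>\<omega>. (Z \<omega>)\<^sup>2) = ((\<Sum>p\<in>?I. c p * expectation (X p)) - m)\<^sup>2
      + (\<Sum>p\<in>?I. (c p)\<^sup>2 * variance (X p))"
    unfolding Z' by (rule second_moment_linear_combination_indep[OF _ ind int sq]) simp
  also have "(\<Sum>p\<in>?I. c p * expectation (X p)) = (\<Sum>s<T. w s) * (\<Sum>i\<in>UNIV. b i * \<mu> i $ j)"
    by (subst sum.cartesian_product', subst sum.swap)
      (simp add: c_def X_def observations_component[OF obs] sum_product mult.assoc)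
  also have "(\<Sum>p\<in>?I. (c p)\<^sup>2 * variance (X p)) = (\<Sum>s<T. (w s)\<^sup>2) * (\<Sum>i\<in>UNIV. (b i)\<^sup>2 * \<Sigma> i $ j $ j)"
    by (subst sum.cartesian_product', subst sum.swap)
      (simp add: c_def X_def observations_component[OF obs] sum_product power_mult_distrib mult.assoc)
  finally show "expectation (\<lambda>\<omega>. (Z \<omega>)\<^sup>2) = ((\<Sum>s<T. w s) * (\<Sum>i\<in>UNIV. b i * \<mu> i $ j) - m)\<^sup>2
      + (\<Sum>s<T. (w s)\<^sup>2) * (\<Sum>i\<in>UNIV. (b i)\<^sup>2 * \<Sigma> i $ j $ j)" .
qed

section \<open>Error bound\<close>

lemma eigenmode_second_moment:
  fixes E :: "('v::finite \<times> 'v) set" and L :: "real^'v^'v" and R :: "'v \<Rightarrow> nat \<Rightarrow> 'w \<Rightarrow> real^'n"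
  assumes M: "prob_space M" and obs: "prob_space.observations M R \<mu> \<Sigma>"
    and L: "gossip_matrix E L" and b: "L *v b = d *\<^sub>R b"
    and T: "T = 2 * T0" "T0 > 0" and a: "a = 1 - \<eta> * d"
    and Z: "Z = (\<lambda>\<omega>. \<Sum>i\<in>UNIV. b $ i * (sda_output E L \<eta> \<zeta> T T0 (\<lambda>i t. R i t \<omega>) i - c) $ j)"
  shows "integrable M (\<lambda>\<omega>. (Z \<omega>)\<^sup>2)"
    and "(\<integral>\<omega>. (Z \<omega>)\<^sup>2 \<partial>M) =
      ((\<Sum>s<T. tail_weight \<zeta> a T0 T s) / real T0 * (\<Sum>i\<in>UNIV. b $ i * \<mu> i $ j) - (\<Sum>i\<in>UNIV. b $ i * c $ j))\<^sup>2
      + (\<Sum>s<T. (tail_weight \<zeta> a T0 T s)\<^sup>2) / (real T0)\<^sup>2 * (\<Sum>i\<in>UNIV. (b $ i)\<^sup>2 * \<Sigma> i $ j $ j)"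
proof -
  interpret prob_space M by fact
  have T0: "real T - real T0 = real T0" "T0 \<le> T" using T by auto
  let ?w = "\<lambda>s. tail_weight \<zeta> a T0 T s / real T0" and ?m = "\<Sum>i\<in>UNIV. b $ i * c $ j"
  have Z': "Z = (\<lambda>\<omega>. (\<Sum>s<T. ?w s * (\<Sum>i\<in>UNIV. b $ i * R i s \<omega> $ j)) - ?m)"
    unfolding Z using sda_output_eigenvector[OF L b T0(2), where j = j]
    by (simp add: right_diff_distrib sum_subtractf a T0(1) sum_divide_distrib)
  show "integrable M (\<lambda>\<omega>. (Z \<omega>)\<^sup>2)" by (rule observations_second_moment(1)[OF obs Z'])
  show "(\<integral>\<omega>. (Z \<omega>)\<^sup>2 \<partial>M) =
      ((\<Sum>s<T. tail_weight \<zeta> a T0 T s) / real T0 * (\<Sum>i\<in>UNIV. b $ i * \<mu> i $ j) - ?m)\<^sup>2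
      + (\<Sum>s<T. (tail_weight \<zeta> a T0 T s)\<^sup>2) / (real T0)\<^sup>2 * (\<Sum>i\<in>UNIV. (b $ i)\<^sup>2 * \<Sigma> i $ j $ j)"
    unfolding observations_second_moment(2)[OF obs Z'] by (simp add: power_divide flip: sum_divide_distrib)
qed

text \<open>
  The window \<open>T0 \<le> t < T\<close> starts no earlier than \<open>k_star \<kappa>\<close>, so the averaged deviation is at most the sum of
  a geometric series, \<open>2 * sqrt \<kappa> * (1 - q / 2) ^ T0 / T0\<close>; the exponential comes from
  \<open>1 - x \<le> exp (- x)\<close> and \<open>T = 2 * T0\<close>.
\<close>

lemma bias_factor_le:
  assumes \<kappa>: "1 \<le> \<kappa>" and q: "q = 1 / sqrt \<kappa>" and \<zeta>: "\<zeta> = (1 - q) / (1 + q)"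
    and a: "0 \<le> a" "a \<le> 1 - q\<^sup>2" and T: "T = 2 * T0" "T0 > 0" "k_star \<kappa> \<le> T0"
  shows "((\<Sum>s<T. tail_weight \<zeta> a T0 T s) / real T0)\<^sup>2
    \<le> 16 * \<kappa> / (real T)\<^sup>2 * exp (- real T / (2 * sqrt \<kappa>))"
proof -
  have q01: "0 < q" "q \<le> 1" using \<kappa> by (auto simp: q)
  have "\<bar>(\<Sum>s<T. tail_weight \<zeta> a T0 T s) / real T0\<bar> \<le> 2 * sqrt \<kappa> * (1 - q / 2) ^ T0 / real T0"
    using abs_sum_tail_weight_le[OF \<kappa> q \<zeta> a T(3), of T] T by (simp add: divide_right_mono)
  also have "(1 - q / 2) ^ T0 \<le> exp (- (q / 2)) ^ T0"
    using q01 exp_ge_add_one_self[of "- (q / 2)"] by (intro power_mono) auto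
  also have "\<dots> = exp (- real T / (4 * sqrt \<kappa>))"
    by (simp add: T q flip: exp_of_nat_mult)
  finally have "\<bar>(\<Sum>s<T. tail_weight \<zeta> a T0 T s) / real T0\<bar>
      \<le> 2 * sqrt \<kappa> * exp (- real T / (4 * sqrt \<kappa>)) / real T0"
    using \<kappa> by (simp add: divide_right_mono mult_left_mono)
  from power_mono[OF this abs_ge_zero, of 2]
  have "((\<Sum>s<T. tail_weight \<zeta> a T0 T s) / real T0)\<^sup>2
      \<le> (2 * sqrt \<kappa> * exp (- real T / (4 * sqrt \<kappa>)) / real T0)\<^sup>2"
    by (simp only: power2_abs)
  also have "\<dots> = 16 * \<kappa> / (real T)\<^sup>2 * (exp (- real T / (4 * sqrt \<kappa>)))\<^sup>2"
    using \<kappa> T by (simp add: power_mult_distrib power_divide)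
  also have "(exp (- real T / (4 * sqrt \<kappa>)))\<^sup>2 = exp (- real T / (2 * sqrt \<kappa>))"
    by (simp flip: exp_of_nat_mult add: power2_eq_square exp_add[symmetric])
  finally show ?thesis .
qed

theorem theorem1:
  fixes E :: "('v::finite \<times> 'v) set"
    and L :: "real^'v^'v"
    and M :: "'w measure"
    and R :: "'v \<Rightarrow> nat \<Rightarrow> 'w \<Rightarrow> real^'n"
    and \<mu> :: "'v \<Rightarrow> real^'n"
    and \<Sigma> :: "'v \<Rightarrow> real^'n^'n"
    and \<mu>_bar :: "real^'n"
    and T T0 :: nat
    and \<kappa> \<eta> \<zeta> :: real
  assumes "CARD('v) \<ge> 2"
    and "connected_simple_graph E"
    and "gossip_matrix E L"
    and "prob_space M"
    and "prob_space.observations M R \<mu> \<Sigma>"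
    and "\<mu>_bar = (1 / real CARD('v)) *\<^sub>R (\<Sum>i\<in>UNIV. \<mu> i)"
    and "\<kappa> = cond_num L"
    and "T > 0"
    and "real T0 = real T / 2"
    and "T0 \<ge> k_star \<kappa>"
    and "\<eta> = 1 / eigval L 1"
    and "\<zeta> = (sqrt \<kappa> - 1) / (sqrt \<kappa> + 1)"
  shows "prob_space.expectation M
           (\<lambda>\<omega>. \<Sum>i\<in>UNIV. (norm (sda_output E L \<eta> \<zeta> T T0 (\<lambda>j t. R j t \<omega>) i - \<mu>_bar))\<^sup>2)
         \<le> 16 * \<kappa> / (real T)\<^sup>2 * exp (- real T / (2 * sqrt \<kappa>)) * (\<Sum>i\<in>UNIV. (norm (\<mu> i - \<mu>_bar))\<^sup>2)
           + 24 * (real (k_star \<kappa>) + sqrt \<kappa>) * (\<Sum>i\<in>UNIV. \<Sum>j\<in>UNIV. \<Sigma> i $ j $ j) / (real T)\<^sup>2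
           + 2 * (\<Sum>j\<in>UNIV. MAX i. \<Sigma> i $ j $ j) / real T"
proof -
  interpret prob_space M by fact
  obtain b :: "'v \<Rightarrow> real^'v" and d k0 where orth: "\<And>k l. b k \<bullet> b l = (if k = l then 1 else 0)"
    and eig: "\<And>k. L *v b k = d k *\<^sub>R b k" and d0: "d k0 = 0" and const: "\<And>i j. b k0 $ i = b k0 $ j"
    and d: "\<And>k. k \<noteq> k0 \<Longrightarrow> eigval L (CARD('v) - 1) \<le> d k \<and> d k \<le> eigval L 1"
    and pos: "0 < eigval L (CARD('v) - 1)" and le: "eigval L (CARD('v) - 1) \<le> eigval L 1"
    using gossip_matrix_eigenbasis[OF assms(1,3)] by metis
  have \<kappa>: "1 \<le> \<kappa>" using pos le by (simp add: assms(7) cond_num_def)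
  define q where "q = 1 / sqrt \<kappa>"
  have \<zeta>: "\<zeta> = (1 - q) / (1 + q)"
  proof -
    have "(s - 1) / (s + 1) = (1 - 1 / s) / (1 + 1 / s)" if "1 \<le> s" for s :: real
    proof -
      have "1 - 1 / s = (s - 1) / s" "1 + 1 / s = (s + 1) / s"
        using that by (simp_all add: field_simps)
      then show ?thesis using that by simp
    qed
    then show ?thesis using \<kappa> by (simp add: assms(12) q_def)
  qed
  have T: "T = 2 * T0" "T0 > 0" using assms(8,9) by auto
  define a where "a k = 1 - \<eta> * d k" for k
  have a: "0 \<le> a k" "a k \<le> 1 - q\<^sup>2" if "k \<noteq> k0" for k
  proof -
    show "0 \<le> a k" using d[OF that] pos le by (simp add: a_def assms(11))
    have "q\<^sup>2 = eigval L (CARD('v) - 1) / eigval L 1"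
      using \<kappa> by (simp add: q_def power_divide assms(7) cond_num_def)
    then show "a k \<le> 1 - q\<^sup>2" using d[OF that] pos le by (simp add: a_def assms(11) divide_right_mono)
  qed
  have a0: "a k0 = 1" by (simp add: a_def d0)
  let ?w = "\<lambda>k s. tail_weight \<zeta> (a k) T0 T s"
  let ?out = "\<lambda>\<omega>. sda_output E L \<eta> \<zeta> T T0 (\<lambda>j t. R j t \<omega>)"
  define Z where "Z k j = (\<lambda>\<omega>. \<Sum>i\<in>UNIV. b k $ i * (?out \<omega> i - \<mu>_bar) $ j)" for k j
  note mode = eigenmode_second_moment[OF assms(4,5,3) eig T a_def Z_def]
  define V where "V = 24 * (real (k_star \<kappa>) + sqrt \<kappa>) / (real T)\<^sup>2"
  define B where "B = 16 * \<kappa> / (real T)\<^sup>2 * exp (- real T / (2 * sqrt \<kappa>))"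
  have V0: "0 \<le> V" and B0: "0 \<le> B" using \<kappa> by (auto simp: V_def B_def)
  have \<Sigma>0: "0 \<le> \<Sigma> i $ j $ j" for i j
    unfolding observations_component(4)[OF assms(5), of i 0 j, symmetric] by simp
  have bk0: "(b k0 $ i)\<^sup>2 = 1 / real CARD('v)" for i
  proof -
    have "(\<Sum>l\<in>(UNIV :: 'v set). (b k0 $ i)\<^sup>2) = b k0 \<bullet> b k0"
      unfolding inner_vec_def power2_eq_square inner_real_def by (intro sum.cong refl arg_cong2[where f = times] const)
    then show ?thesis by (simp add: orth field_simps)
  qed
  have sum_b: "(\<Sum>i\<in>UNIV. b k $ i) = 0" if "k \<noteq> k0" for k
  proof -
    fix i0 :: 'v
    have "b k0 $ i0 * (\<Sum>i\<in>UNIV. b k $ i) = b k0 \<bullet> b k"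
      unfolding inner_vec_def inner_real_def sum_distrib_left
      by (intro sum.cong refl arg_cong2[where f = times] const)
    then show ?thesis using orth[of k0 k] bk0[of i0] that by (auto split: if_splits)
  qed
  have dev: "(\<Sum>i\<in>UNIV. \<mu> i $ j - \<mu>_bar $ j) = 0" for j
    by (simp add: assms(6) sum_subtractf)
  \<comment> \<open>The constant mode \<open>k0\<close> is unbiased, as its weights have mean 1 and it sees the true average; the
    other modes are orthogonal to \<open>\<mu>_bar\<close>, so their whole response is bias.\<close>
  have bias: "((\<Sum>s<T. ?w k s) / real T0 * (\<Sum>i\<in>UNIV. b k $ i * \<mu> i $ j) - (\<Sum>i\<in>UNIV. b k $ i * \<mu>_bar $ j))\<^sup>2
      \<le> B * (\<Sum>i\<in>UNIV. b k $ i * (\<mu> i $ j - \<mu>_bar $ j))\<^sup>2" for k j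
  proof (cases "k = k0")
    case True
    fix i0 :: 'v
    have "(\<Sum>s<T. ?w k s) / real T0 = 1"
      using T by (simp add: True a0 sum_tail_weight damping_one)
    moreover have "(\<Sum>i\<in>UNIV. b k0 $ i * (\<mu> i $ j - \<mu>_bar $ j)) = b k0 $ i0 * (\<Sum>i\<in>UNIV. \<mu> i $ j - \<mu>_bar $ j)"
      unfolding sum_distrib_left by (intro sum.cong refl arg_cong2[where f = times] const)
    ultimately show ?thesis
      using dev by (simp add: True right_diff_distrib sum_subtractf)
  next
    case False
    have "(\<Sum>i\<in>UNIV. b k $ i * \<mu>_bar $ j) = 0"
      using sum_b[OF False] by (simp flip: sum_distrib_right)
    moreover from this have "(\<Sum>i\<in>UNIV. b k $ i * (\<mu> i $ j - \<mu>_bar $ j)) = (\<Sum>i\<in>UNIV. b k $ i * \<mu> i $ j)"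
      by (simp add: right_diff_distrib sum_subtractf)
    ultimately show ?thesis
      using mult_right_mono[OF bias_factor_le[OF \<kappa> q_def \<zeta> a[OF False] T assms(10)]
          zero_le_power2[of "\<Sum>i\<in>UNIV. b k $ i * \<mu> i $ j"]]
      by (simp only: B_def power_mult_distrib diff_0_right)
  qed
  \<comment> \<open>The constant mode is a plain average over the window, whose variance is an average of the node
    variances divided by \<open>T0\<close>. Adding the nonnegative \<open>V\<close> term there as well lets the sum over all
    modes be evaluated by orthonormality of the columns.\<close>
  have noise: "(\<Sum>s<T. (?w k s)\<^sup>2) / (real T0)\<^sup>2 * (\<Sum>i\<in>UNIV. (b k $ i)\<^sup>2 * \<Sigma> i $ j $ j)
      \<le> V * (\<Sum>i\<in>UNIV. (b k $ i)\<^sup>2 * \<Sigma> i $ j $ j) + (if k = k0 then 2 * (MAX i. \<Sigma> i $ j $ j) / real T else 0)" for k j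
  proof (cases "k = k0")
    case True
    have "(\<Sum>i\<in>UNIV. (b k0 $ i)\<^sup>2 * \<Sigma> i $ j $ j) \<le> (\<Sum>i\<in>(UNIV :: 'v set). 1 / real CARD('v) * (MAX i. \<Sigma> i $ j $ j))"
      unfolding bk0 by (intro sum_mono mult_left_mono) auto
    then have "(\<Sum>i\<in>UNIV. (b k0 $ i)\<^sup>2 * \<Sigma> i $ j $ j) \<le> (MAX i. \<Sigma> i $ j $ j)" by simp
    moreover have "(\<Sum>s<T. (?w k s)\<^sup>2) / (real T0)\<^sup>2 = 2 / real T"
    proof -
      have window: "(\<Sum>s<T. (?w k s)\<^sup>2) = real T0"
        using sum_tail_weight_one_squares[of T0 T \<zeta>] T by (simp add: True a0)
      show ?thesis unfolding window using T by (simp add: power2_eq_square)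
    qed
    moreover have "0 \<le> V * (\<Sum>i\<in>UNIV. (b k0 $ i)\<^sup>2 * \<Sigma> i $ j $ j)"
      using V0 \<Sigma>0 by (intro mult_nonneg_nonneg sum_nonneg) auto
    ultimately show ?thesis
      using T by (simp add: True divide_right_mono add_increasing)
  next
    case False
    have "(\<Sum>s<T. (?w k s)\<^sup>2) / (real T0)\<^sup>2 \<le> 6 * (k_star \<kappa> + sqrt \<kappa>) / (real T0)\<^sup>2"
      using sum_tail_weight_squares_le[OF \<kappa> q_def \<zeta> a[OF False], of T0] T by (simp add: divide_right_mono)
    also have "\<dots> = V" using T(2) by (simp add: V_def T(1) power_mult_distrib divide_simps)
    finally have "(\<Sum>s<T. (?w k s)\<^sup>2) / (real T0)\<^sup>2 \<le> V" .
    moreover have "0 \<le> (\<Sum>i\<in>UNIV. (b k $ i)\<^sup>2 * \<Sigma> i $ j $ j)" using \<Sigma>0 by (simp add: sum_nonneg)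
    ultimately show ?thesis using False by (simp only: if_False add_0_right mult_right_mono)
  qed
  \<comment> \<open>Parseval turns the total squared error into a sum over modes and components, to each of which the
    two bounds apply.\<close>
  have "expectation (\<lambda>\<omega>. \<Sum>i\<in>UNIV. (norm (?out \<omega> i - \<mu>_bar))\<^sup>2) = expectation (\<lambda>\<omega>. \<Sum>j\<in>UNIV. \<Sum>k\<in>UNIV. (Z k j \<omega>)\<^sup>2)"
  proof (rule Bochner_Integration.integral_cong[OF refl])
    fix \<omega>
    have "(\<Sum>i\<in>UNIV. (norm (?out \<omega> i - \<mu>_bar))\<^sup>2) = (\<Sum>j\<in>UNIV. \<Sum>i\<in>UNIV. ((?out \<omega> i - \<mu>_bar) $ j)\<^sup>2)"
      unfolding power2_norm_eq_inner inner_vec_def by (subst sum.swap) (simp add: power2_eq_square)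
    also have "\<dots> = (\<Sum>j\<in>UNIV. \<Sum>k\<in>UNIV. (Z k j \<omega>)\<^sup>2)"
      unfolding Z_def by (rule sum.cong[OF refl orthonormal_parseval[OF orth]])
    finally show "(\<Sum>i\<in>UNIV. (norm (?out \<omega> i - \<mu>_bar))\<^sup>2) = (\<Sum>j\<in>UNIV. \<Sum>k\<in>UNIV. (Z k j \<omega>)\<^sup>2)" .
  qed
  also have "\<dots> = (\<Sum>j\<in>UNIV. \<Sum>k\<in>UNIV. expectation (\<lambda>\<omega>. (Z k j \<omega>)\<^sup>2))"
    using mode(1) by (subst Bochner_Integration.integral_sum; simp)
  also have "\<dots> \<le> (\<Sum>j\<in>UNIV. \<Sum>k\<in>UNIV. B * (\<Sum>i\<in>UNIV. b k $ i * (\<mu> i $ j - \<mu>_bar $ j))\<^sup>2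
      + (V * (\<Sum>i\<in>UNIV. (b k $ i)\<^sup>2 * \<Sigma> i $ j $ j) + (if k = k0 then 2 * (MAX i. \<Sigma> i $ j $ j) / real T else 0)))"
    unfolding mode(2) by (intro sum_mono add_mono bias noise)
  also have "\<dots> = (\<Sum>j\<in>UNIV. B * (\<Sum>i\<in>UNIV. (\<mu> i $ j - \<mu>_bar $ j)\<^sup>2)
      + (V * (\<Sum>i\<in>UNIV. \<Sigma> i $ j $ j) + 2 * (MAX i. \<Sigma> i $ j $ j) / real T))"
  proof (rule sum.cong[OF refl])
    fix j
    have "(\<Sum>k\<in>UNIV. \<Sum>i\<in>UNIV. (b k $ i)\<^sup>2 * \<Sigma> i $ j $ j) = (\<Sum>i\<in>UNIV. \<Sigma> i $ j $ j)"
      using orthonormal_columns[OF orth]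
      by (subst sum.swap) (simp add: power2_eq_square flip: sum_distrib_right)
    then show "(\<Sum>k\<in>UNIV. B * (\<Sum>i\<in>UNIV. b k $ i * (\<mu> i $ j - \<mu>_bar $ j))\<^sup>2
      + (V * (\<Sum>i\<in>UNIV. (b k $ i)\<^sup>2 * \<Sigma> i $ j $ j) + (if k = k0 then 2 * (MAX i. \<Sigma> i $ j $ j) / real T else 0)))
      = B * (\<Sum>i\<in>UNIV. (\<mu> i $ j - \<mu>_bar $ j)\<^sup>2)
      + (V * (\<Sum>i\<in>UNIV. \<Sigma> i $ j $ j) + 2 * (MAX i. \<Sigma> i $ j $ j) / real T)"
      unfolding orthonormal_parseval[OF orth, of "\<lambda>i. \<mu> i $ j - \<mu>_bar $ j"]
      by (simp add: sum.distrib flip: sum_distrib_left)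
  qed
  also have "\<dots> = B * (\<Sum>i\<in>UNIV. (norm (\<mu> i - \<mu>_bar))\<^sup>2) + V * (\<Sum>i\<in>UNIV. \<Sum>j\<in>UNIV. \<Sigma> i $ j $ j)
      + 2 * (\<Sum>j\<in>UNIV. MAX i. \<Sigma> i $ j $ j) / real T"
  proof -
    have "(\<Sum>j\<in>UNIV. \<Sum>i\<in>UNIV. (\<mu> i $ j - \<mu>_bar $ j)\<^sup>2) = (\<Sum>i\<in>UNIV. (norm (\<mu> i - \<mu>_bar))\<^sup>2)"
      unfolding power2_norm_eq_inner inner_vec_def by (subst sum.swap) (simp add: power2_eq_square)
    moreover have "(\<Sum>j\<in>UNIV. \<Sum>i\<in>UNIV. \<Sigma> i $ j $ j) = (\<Sum>i\<in>UNIV. \<Sum>j\<in>UNIV. \<Sigma> i $ j $ j)"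
      by (rule sum.swap)
    ultimately show ?thesis
      by (simp add: sum.distrib flip: sum_distrib_left sum_divide_distrib)
  qed
  finally show ?thesis by (simp add: B_def V_def)
qed

end
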